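(* Let $0<\lambda<1$, let $\rho_1,\rho_2,\sigma_1,\sigma_2$ be strictly positive matrices on the same Hilbert space, and let $f$ be operator convex. Put $\rho_\lambda=\lambda\rho_1+(1-\lambda)\rho_2$ and $\sigma_\lambda=\lambda\sigma_1+(1-\lambda)\sigma_2$. Then $$S_f\left(\rho_\lambda\,||\,\sigma_\lambda\right)\ \leq\ \lambda S_f(\rho_1||\sigma_1)+(1-\lambda)S_f(\rho_2||\sigma_2).$$ For a non-affine and diffused operator convex function $f$, equality holds if and only if $$\mathrm{Tr}\left(\sigma_\lambda^{\imath t}\rho_\lambda^{-\imath t+1}\right)=\lambda\,\mathrm{Tr}\left(\sigma_1^{\imath t}\rho_1^{-\imath t+1}\right)+(1-\lambda)\,\mathrm{Tr}\left(\sigma_2^{\imath t}\rho_2^{-\imath t+1}\right)\qquad\text{for all } t\in\mathbb{C},$$ where $\imath=\sqrt{-1}$.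
   Context: All Hilbert spaces are finite-dimensional and complex. "Strictly positive" means Hermitian positive definite; no trace normalization is assumed. For Hermitian $A$, $f(A)$ is defined by the spectral decomposition; for strictly positive $X$ and $z\in\mathbb{C}$, $X^z=\exp(z\ln X)$. A real function $f$ on an interval is operator convex if $f[\lambda A+(1-\lambda)B]\leq\lambda f(A)+(1-\lambda)f(B)$ for all Hermitian matrices $A,B$ (of the same, arbitrary size) with spectra in the domain of $f$ and all $0\le\lambda\le1$. Diffused: a non-affine operator convex function $f$ on $(t_0-a,t_0+a)$, $a>0$, is called diffused if it has the representation $$f(t)=b+ct+\kappa\int_{-a}^{a}\frac{(t-t_0)^2}{a^2-(t-t_0)x}\,p_X(x)\,dx$$ with $b,c\in\mathbb{R}$, $\kappa>0$ and $p_X$ a probability density function on $[-a,a]$ that is strictly positive almost everywhere on a (nondegenerate) subinterval of $[-a,a]$ having $x=0$ as an interior or boundary point. Quantum $f$-relative entropy: for strictly positive $\rho,\sigma$ on the same $d$-dimensional space, $$S_f(\rho||\sigma)=\mathrm{vec}(\sqrt{\rho})^\dagger f\left[\sigma\otimes(\rho^{-1})^{\mathsf T}\right]\mathrm{vec}(\sqrt{\rho})=\sum_{i,j=1}^d p_i f\left(\frac{q_j}{p_i}\right)|\langle i_\rho|j_\sigma\rangle|^2,$$ where $\rho=\sum_i p_i|i_\rho\rangle\langle i_\rho|$ and $\sigma=\sum_j q_j|j_\sigma\rangle\langle j_\sigma|$ are spectral decompositions and $\mathrm{vec}(A)$ stacks the entries of $A$ row by row. Standing convention: the domain of $f$ is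 an interval of positive reals (contained in $(0,\alpha)$ for some finite $\alpha$) which contains the eigenvalue ratios $q_j/p_i$ for every $S_f(\rho||\sigma)$ that occurs. *)

theory Defs
  imports
    "HOL-Analysis.Analysis"
    "Jordan_Normal_Form.Schur_Decomposition"
    "Jordan_Normal_Form.Spectral_Radius"
    "Jordan_Normal_Form.Gauss_Jordan_Elimination"
begin

hide_const (open) Finite_Cartesian_Product.vec Finite_Cartesian_Product.mat
  Finite_Cartesian_Product.row Finite_Cartesian_Product.column
  Determinants.det
unbundle no vec_syntax

definition hermitian_mat :: "nat \<Rightarrow> complex mat \<Rightarrow> bool" where
  "hermitian_mat n A \<longleftrightarrow> A \<in> carrier_mat n n \<and> mat_adjoint A = A"

definition pos_semidef_mat :: "nat \<Rightarrow> complex mat \<Rightarrow> bool" where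
  "pos_semidef_mat n A \<longleftrightarrow> hermitian_mat n A \<and>
     (\<forall>v \<in> carrier_vec n. 0 \<le> Re ((A *\<^sub>v v) \<bullet>c v))"

definition pos_def_mat :: "nat \<Rightarrow> complex mat \<Rightarrow> bool" where
  "pos_def_mat n A \<longleftrightarrow> hermitian_mat n A \<and>
     (\<forall>v \<in> carrier_vec n. v \<noteq> 0\<^sub>v n \<longrightarrow> 0 < Re ((A *\<^sub>v v) \<bullet>c v))"

definition unitary_mat :: "nat \<Rightarrow> complex mat \<Rightarrow> bool" where
  "unitary_mat n U \<longleftrightarrow> U \<in> carrier_mat n n \<and>
     U * mat_adjoint U = 1\<^sub>m n \<and> mat_adjoint U * U = 1\<^sub>m n"

definition mat_trace :: "complex mat \<Rightarrow> complex" where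
  "mat_trace A = (\<Sum>i<dim_row A. A $$ (i, i))"

text \<open>Functional calculus: \<open>U diag(d) U\<^sup>\<dagger>\<close> is mapped to \<open>U diag(f d) U\<^sup>\<dagger>\<close>. It covers all normal
  matrices, not only Hermitian ones, because \<open>z ln X\<close> below is normal but in general not Hermitian.
  The lemma \<open>mat_fun_unitary_diag\<close> shows that the result does not depend on the choice of
  the decomposition. The value is unspecified for matrices that are not normal.\<close>

definition mat_fun :: "(complex \<Rightarrow> complex) \<Rightarrow> complex mat \<Rightarrow> complex mat" where
  "mat_fun f A = (SOME B. \<exists>U d. unitary_mat (dim_row A) U \<and>
     A = U * mat_diag (dim_row A) d * mat_adjoint U \<and>
     B = U * mat_diag (dim_row A) (\<lambda>i. f (d i)) * mat_adjoint U)"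

lemma adjoint_carrier:
  "U \<in> carrier_mat n n \<Longrightarrow> mat_adjoint U \<in> carrier_mat n n"
  unfolding mat_adjoint_def by (auto simp: mat_of_rows_def)

lemma unitary_diag_fun_unique:
  assumes U: "unitary_mat n U" and V: "unitary_mat n V"
    and eq: "U * mat_diag n d * mat_adjoint U = V * mat_diag n e * mat_adjoint V"
  shows "U * mat_diag n (\<lambda>i. f (d i)) * mat_adjoint U
       = V * mat_diag n (\<lambda>i. f (e i)) * mat_adjoint V"
proof -
  note [simp] = mult_carrier_mat[of _ n n _ n]
  define X where "X = mat_adjoint U"
  define Y where "Y = mat_adjoint V"
  have c[simp]: "U \<in> carrier_mat n n" "V \<in> carrier_mat n n" "X \<in> carrier_mat n n" "Y \<in> carrier_mat n n"
    using U V by (auto simp: unitary_mat_def X_def Y_def intro: adjoint_carrier)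
  have inv: "X * U = 1\<^sub>m n" "U * X = 1\<^sub>m n" "Y * V = 1\<^sub>m n" "V * Y = 1\<^sub>m n"
    using U V by (auto simp: unitary_mat_def X_def Y_def)
  define W where "W = Y * U"
  have W[simp]: "W \<in> carrier_mat n n" by (simp add: W_def)
  have D[simp]: "\<And>g. mat_diag n g \<in> carrier_mat n n" by simp
  have "W * mat_diag n d = Y * (U * mat_diag n d * X) * U"
  proof -
    have "Y * (U * mat_diag n d * X) * U = Y * U * mat_diag n d * (X * U)"
      by (simp add: assoc_mult_mat[of _ n n _ n _ n])
    then show ?thesis by (simp add: inv W_def right_mult_one_mat[of _ n n])
  qed
  also have "\<dots> = Y * (V * mat_diag n e * Y) * U" using eq by (simp add: X_def Y_def)
  also have "\<dots> = (Y * V) * mat_diag n e * W"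
    by (simp add: W_def assoc_mult_mat[of _ n n _ n _ n])
  also have "\<dots> = mat_diag n e * W" by (simp add: inv left_mult_one_mat[of _ n n] right_mult_one_mat[of _ n n])
  finally have comm: "W * mat_diag n d = mat_diag n e * W" .
  have "W * mat_diag n (\<lambda>i. f (d i)) = mat_diag n (\<lambda>i. f (e i)) * W"
  proof (rule eq_matI)
    fix i j assume "i < dim_row (mat_diag n (\<lambda>i. f (e i)) * W)" "j < dim_col (mat_diag n (\<lambda>i. f (e i)) * W)"
    then have ij: "i < n" "j < n" using W by (auto simp: mat_diag_def)
    have "(W * mat_diag n d) $$ (i,j) = (mat_diag n e * W) $$ (i,j)" by (simp only: comm)
    then have "W $$ (i,j) * d j = e i * W $$ (i,j)"
      using ij by (simp add: mat_diag_mult_left[OF W] mat_diag_mult_right[OF W])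
    then have "W $$ (i,j) = 0 \<or> d j = e i" by auto
    then show "(W * mat_diag n (\<lambda>i. f (d i))) $$ (i,j) = (mat_diag n (\<lambda>i. f (e i)) * W) $$ (i,j)"
      using ij by (auto simp: mat_diag_mult_left[OF W] mat_diag_mult_right[OF W])
  qed (use carrier_matD[OF W] in \<open>simp_all add: mat_diag_def\<close>)
  note c2 = this
  have "U * mat_diag n (\<lambda>i. f (d i)) * X = (V * Y) * U * mat_diag n (\<lambda>i. f (d i)) * X"
    by (simp add: inv left_mult_one_mat[of _ n n] right_mult_one_mat[of _ n n])
  also have "\<dots> = V * (W * mat_diag n (\<lambda>i. f (d i))) * X"
    by (simp add: W_def assoc_mult_mat[of _ n n _ n _ n])
  also have "\<dots> = V * mat_diag n (\<lambda>i. f (e i)) * (Y * (U * X))"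
    unfolding c2 by (simp add: W_def assoc_mult_mat[of _ n n _ n _ n])
  finally show ?thesis by (simp add: inv left_mult_one_mat[of _ n n] right_mult_one_mat[of _ n n] X_def[symmetric] Y_def[symmetric])
qed

lemma mat_fun_unitary_diag:
  assumes U: "unitary_mat n U"
  shows "mat_fun f (U * mat_diag n d * mat_adjoint U)
       = U * mat_diag n (\<lambda>i. f (d i)) * mat_adjoint U"
proof -
  have n: "dim_row (U * mat_diag n d * mat_adjoint U) = n"
    using U by (auto simp: unitary_mat_def)
  show ?thesis
    unfolding mat_fun_def n
  proof (rule someI2_ex)
    show "\<exists>B V e. unitary_mat n V \<and>
      U * mat_diag n d * mat_adjoint U = V * mat_diag n e * mat_adjoint V \<and>
      B = V * mat_diag n (\<lambda>i. f (e i)) * mat_adjoint V"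
      using U by blast
  next
    fix B
    assume "\<exists>V e. unitary_mat n V \<and>
      U * mat_diag n d * mat_adjoint U = V * mat_diag n e * mat_adjoint V \<and>
      B = V * mat_diag n (\<lambda>i. f (e i)) * mat_adjoint V"
    then obtain V e where "unitary_mat n V"
      "U * mat_diag n d * mat_adjoint U = V * mat_diag n e * mat_adjoint V"
      "B = V * mat_diag n (\<lambda>i. f (e i)) * mat_adjoint V"
      by auto
    then show "B = U * mat_diag n (\<lambda>i. f (d i)) * mat_adjoint U"
      using unitary_diag_fun_unique[OF U, of V d e f] by simp
  qed
qed

abbreviation mat_real_fun :: "(real \<Rightarrow> real) \<Rightarrow> complex mat \<Rightarrow> complex mat" where
  "mat_real_fun f \<equiv> mat_fun (\<lambda>z. complex_of_real (f (Re z)))"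

definition mat_powc :: "complex mat \<Rightarrow> complex \<Rightarrow> complex mat" where
  "mat_powc X z = mat_fun exp (z \<cdot>\<^sub>m mat_real_fun ln X)"

definition mat_combination :: "real \<Rightarrow> complex mat \<Rightarrow> complex mat \<Rightarrow> complex mat" where
  "mat_combination \<mu> A B = complex_of_real \<mu> \<cdot>\<^sub>m A + complex_of_real (1 - \<mu>) \<cdot>\<^sub>m B"

definition operator_convex_on :: "real set \<Rightarrow> (real \<Rightarrow> real) \<Rightarrow> bool" where
  "operator_convex_on I f \<longleftrightarrow>
     (\<forall>n A B \<mu>. hermitian_mat n A \<longrightarrow> hermitian_mat n B \<longrightarrow>
        spectrum A \<subseteq> complex_of_real ` I \<longrightarrow> spectrum B \<subseteq> complex_of_real ` I \<longrightarrow>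
        0 \<le> \<mu> \<longrightarrow> \<mu> \<le> 1 \<longrightarrow>
        pos_semidef_mat n
          (mat_combination \<mu> (mat_real_fun f A) (mat_real_fun f B)
             - mat_real_fun f (mat_combination \<mu> A B)))"

definition affine_fun_on :: "real set \<Rightarrow> (real \<Rightarrow> real) \<Rightarrow> bool" where
  "affine_fun_on I f \<longleftrightarrow> (\<exists>b c. \<forall>t\<in>I. f t = b + c * t)"

definition prob_density_on :: "real set \<Rightarrow> (real \<Rightarrow> real) \<Rightarrow> bool" where
  "prob_density_on S p \<longleftrightarrow> (\<forall>x\<in>S. 0 \<le> p x) \<and> set_integrable lborel S p \<and>
     (LINT x:S|lborel. p x) = 1"

text \<open>In \<open>diffused\<close>, \<open>u\<close> and \<open>v\<close> are the end points of the subinterval near \<open>0\<close>; whether they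
  belong to it is immaterial for an almost-everywhere condition.\<close>

definition diffused :: "real \<Rightarrow> real \<Rightarrow> (real \<Rightarrow> real) \<Rightarrow> bool" where
  "diffused t\<^sub>0 a f \<longleftrightarrow>
     0 < a \<and>
     operator_convex_on {t\<^sub>0 - a<..<t\<^sub>0 + a} f \<and>
     \<not> affine_fun_on {t\<^sub>0 - a<..<t\<^sub>0 + a} f \<and>
     (\<exists>b c \<kappa> p. 0 < \<kappa> \<and> prob_density_on {-a..a} p \<and>
        (\<exists>u v. - a \<le> u \<and> u < v \<and> v \<le> a \<and> u \<le> 0 \<and> 0 \<le> v \<and>
           (AE x in lborel. x \<in> {u<..<v} \<longrightarrow> 0 < p x)) \<and>
        (\<forall>t\<in>{t\<^sub>0 - a<..<t\<^sub>0 + a}. f t = b + c * t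
           + \<kappa> * (LINT x:{-a..a}|lborel. (t - t\<^sub>0)\<^sup>2 / (a\<^sup>2 - (t - t\<^sub>0) * x) * p x)))"

definition kronecker_mat :: "complex mat \<Rightarrow> complex mat \<Rightarrow> complex mat" where
  "kronecker_mat A B = Matrix.mat (dim_row A * dim_row B) (dim_col A * dim_col B)
     (\<lambda>(i, j). A $$ (i div dim_row B, j div dim_col B) * B $$ (i mod dim_row B, j mod dim_col B))"

definition vec_of_rows :: "complex mat \<Rightarrow> complex vec" where
  "vec_of_rows A = Matrix.vec (dim_row A * dim_col A) (\<lambda>i. A $$ (i div dim_col A, i mod dim_col A))"

text \<open>\<open>(M *\<^sub>v v) \<bullet>c v\<close> is \<open>v\<^sup>\<dagger> M v\<close>. It is real for positive definite arguments, since then \<open>M\<close> is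
  Hermitian, so that \<open>Re\<close> only changes the type. The option type of \<open>mat_inverse\<close> accounts for
  singular matrices.\<close>

definition quantum_f_rel_entropy ::
  "(real \<Rightarrow> real) \<Rightarrow> complex mat \<Rightarrow> complex mat \<Rightarrow> real" where
  "quantum_f_rel_entropy f \<rho> \<sigma> =
     (let v = vec_of_rows (mat_real_fun sqrt \<rho>);
          M = mat_real_fun f (kronecker_mat \<sigma> (transpose_mat (the (mat_inverse \<rho>))))
      in Re ((M *\<^sub>v v) \<bullet>c v))"

definition eigenvalue_ratios_in :: "real set \<Rightarrow> complex mat \<Rightarrow> complex mat \<Rightarrow> bool" where
  "eigenvalue_ratios_in I \<rho> \<sigma> \<longleftrightarrow>
     (\<forall>p\<in>spectrum \<rho>. \<forall>q\<in>spectrum \<sigma>. q / p \<in> complex_of_real ` I)"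

end

theory Submission
  imports Defs
begin

text \<open>Let \<open>\<Delta>\<close> and \<open>\<Delta>\<^sub>b\<close> be the relative modular operators \<open>X \<mapsto> \<sigma> X \<rho>\<^sup>-\<^sup>1\<close> of the mixture and of its two
  components. There is an isometry \<open>V\<close> with \<open>V\<^sup>* (\<Delta>\<^sub>1 \<oplus> \<Delta>\<^sub>2) V = \<Delta>\<close> that maps \<open>\<surd>\<rho>\<close> to the pair of
  vectors \<open>\<surd>\<lambda>\<^sub>b \<surd>\<rho>\<^sub>b\<close>, so joint convexity is Jensen's operator inequality for \<open>V\<close>. In eigenbases
  the difference of the two sides is \<open>D f = \<Sum>\<^sub>j c\<^sub>j f r\<^sub>j\<close> with finitely many real atoms that depend only
  on the states. If \<open>f\<close> is diffused and \<open>D f = 0\<close>, then \<open>D\<close> annihilates the kernels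
  \<open>(t - t\<^sub>0)\<^sup>2 / (a\<^sup>2 - (t - t\<^sub>0) y)\<close> for infinitely many \<open>y\<close>, because \<open>D\<close> has a constant sign on them;
  their poles as rational functions of \<open>y\<close> separate the atoms, hence \<open>D = 0\<close>. The trace identities
  say that \<open>D\<close> annihilates all powers \<open>r\<^sup>z\<close>, which also means \<open>D = 0\<close>, by interpolation.\<close>

section \<open>Adjoints, unitary matrices and the spectral theorem\<close>

text \<open>Jensen's inequality for \<open>f\<close> gives only the sign of \<open>D f\<close>. The
  equality case needs the sign of \<open>D\<close> on every single kernel, and the operator
  convexity of the kernels is not part of the definition of \<open>diffused\<close>. They get a
  direct argument: with \<open>s\<close> and \<open>m\<close> affine in \<open>t\<close>, the value
  \<open>s^2 / m\<close> is a supremum of expressions linear in \<open>s\<close> and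
  \<open>m\<close>, and \<open>D\<close> annihilates affine functions because an isometry preserves
  them under compression. One atom escapes the poles, the one at \<open>t\<^sub>0\<close>, where all
  kernels vanish. It is recovered from the total mass \<open>D 1 = 0\<close>. On the trace side the
  nonnegative integer exponents already determine the atoms, and vanishing atoms give back all
  complex exponents. The maps go between spaces of dimensions n^2 and 2 n^2 that carry several
  eigenbases. They are therefore written as scalar arrays indexed by pairs and triples, and the
  analytic part knows only two facts about the array \<open>V\<close>: its columns are orthonormal,
  and it compresses one diagonal operator to another.\<close>

lemma index_adjoint:
  assumes "A \<in> carrier_mat n m" "i < m" "j < n"
  shows "mat_adjoint A $$ (i, j) = cnj (A $$ (j, i))"
  using assms unfolding mat_adjoint_def by (auto simp: mat_of_rows_def)

lemma adjoint_carrier_rect [simp]: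
  "A \<in> carrier_mat n m \<Longrightarrow> mat_adjoint A \<in> carrier_mat m n"
  unfolding mat_adjoint_def by (auto simp: mat_of_rows_def)

lemma dim_adjoint [simp]:
  "dim_row (mat_adjoint A) = dim_col A" "dim_col (mat_adjoint A) = dim_row A"
  unfolding mat_adjoint_def by (auto simp: mat_of_rows_def)

lemma index_mult_sum:
  assumes "A \<in> carrier_mat n m" "B \<in> carrier_mat m k" "i < n" "j < k"
  shows "(A * B) $$ (i, j) = (\<Sum>l<m. A $$ (i, l) * B $$ (l, j))"
  using assms by (auto simp: scalar_prod_def lessThan_atLeast0 intro!: sum.cong)

lemma index_mult_vec_sum:
  assumes "A \<in> carrier_mat n m" "v \<in> carrier_vec m" "i < n"
  shows "(A *\<^sub>v v) $ i = (\<Sum>l<m. A $$ (i, l) * v $ l)"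
  using assms by (auto simp: scalar_prod_def lessThan_atLeast0 intro!: sum.cong)

lemma cscalar_prod_sum:
  assumes "v \<in> carrier_vec n" "w \<in> carrier_vec n"
  shows "v \<bullet>c w = (\<Sum>i<n. v $ i * cnj (w $ i))"
  using assms by (auto simp: scalar_prod_def lessThan_atLeast0 intro!: sum.cong)

lemma adjoint_mult:
  fixes A B :: "complex mat"
  assumes A: "A \<in> carrier_mat n m" and B: "B \<in> carrier_mat m k"
  shows "mat_adjoint (A * B) = mat_adjoint B * mat_adjoint A"
proof (rule eq_matI)
  have AB: "A * B \<in> carrier_mat n k" using A B by simp
  note car = adjoint_carrier_rect[OF A] adjoint_carrier_rect[OF B] adjoint_carrier_rect[OF AB]
  show "dim_row (mat_adjoint (A * B)) = dim_row (mat_adjoint B * mat_adjoint A)"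
    "dim_col (mat_adjoint (A * B)) = dim_col (mat_adjoint B * mat_adjoint A)"
    by auto
  fix i j assume "i < dim_row (mat_adjoint B * mat_adjoint A)" "j < dim_col (mat_adjoint B * mat_adjoint A)"
  then have ij: "i < k" "j < n" using car by auto
  show "mat_adjoint (A * B) $$ (i, j) = (mat_adjoint B * mat_adjoint A) $$ (i, j)"
    using ij by (simp add: index_adjoint[OF AB ij] index_mult_sum[OF A B] index_mult_sum[OF car(2,1)]
        index_adjoint[OF A] index_adjoint[OF B] mult.commute del: index_mult_mat(1))
qed

lemma adjoint_adjoint:
  fixes A :: "complex mat"
  assumes A: "A \<in> carrier_mat n m"
  shows "mat_adjoint (mat_adjoint A) = A"
proof (rule eq_matI)
  note car = adjoint_carrier_rect[OF A] adjoint_carrier_rect[OF adjoint_carrier_rect[OF A]]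
  show "dim_row (mat_adjoint (mat_adjoint A)) = dim_row A"
    "dim_col (mat_adjoint (mat_adjoint A)) = dim_col A"
    by auto
  fix i j assume "i < dim_row A" "j < dim_col A"
  then show "mat_adjoint (mat_adjoint A) $$ (i, j) = A $$ (i, j)"
    using A by (simp add: index_adjoint[OF car(1)] index_adjoint[OF A])
qed

lemma unitary_matI_left:
  assumes U: "U \<in> carrier_mat n n"
    and orth: "\<And>i j. i < n \<Longrightarrow> j < n \<Longrightarrow> (\<Sum>k<n. cnj (U $$ (k, i)) * U $$ (k, j)) = (if i = j then 1 else 0)"
  shows "unitary_mat n U"
proof -
  note c = adjoint_carrier_rect[OF U]
  have 1: "mat_adjoint U * U = 1\<^sub>m n"
  proof (rule eq_matI)
    fix i j assume "i < dim_row (1\<^sub>m n)" "j < dim_col (1\<^sub>m n)"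
    then have ij: "i < n" "j < n" by auto
    then show "(mat_adjoint U * U) $$ (i, j) = 1\<^sub>m n $$ (i, j)"
      using orth[OF ij] by (simp add: index_mult_sum[OF c U] index_adjoint[OF U])
  qed (use U in auto)
  then have "U * mat_adjoint U = 1\<^sub>m n"
    using mat_mult_left_right_inverse[OF c U] by blast
  with 1 U show ?thesis by (simp add: unitary_mat_def)
qed

lemma unitary_columns:
  assumes "unitary_mat n U" "i < n" "j < n"
  shows "(\<Sum>k<n. cnj (U $$ (k, i)) * U $$ (k, j)) = (if i = j then 1 else 0)"
proof -
  have U: "U \<in> carrier_mat n n" and "mat_adjoint U * U = 1\<^sub>m n"
    using assms(1) by (auto simp: unitary_mat_def)
  then have "(mat_adjoint U * U) $$ (i, j) = 1\<^sub>m n $$ (i, j)" by simp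
  then show ?thesis
    using assms(2,3) by (simp add: index_mult_sum[OF adjoint_carrier_rect[OF U] U] index_adjoint[OF U])
qed

lemma unitary_rows:
  assumes "unitary_mat n U" "i < n" "j < n"
  shows "(\<Sum>k<n. U $$ (i, k) * cnj (U $$ (j, k))) = (if i = j then 1 else 0)"
proof -
  have U: "U \<in> carrier_mat n n" and "U * mat_adjoint U = 1\<^sub>m n"
    using assms(1) by (auto simp: unitary_mat_def)
  then have "(U * mat_adjoint U) $$ (i, j) = 1\<^sub>m n $$ (i, j)" by simp
  then show ?thesis
    using assms(2,3) by (simp add: index_mult_sum[OF U adjoint_carrier_rect[OF U]] index_adjoint[OF U])
qed

lemma index_unitary_diag:
  assumes U: "U \<in> carrier_mat n n" and ij: "i < n" "j < n"
  shows "(U * mat_diag n d * mat_adjoint U) $$ (i, j) = (\<Sum>k<n. U $$ (i, k) * d k * cnj (U $$ (j, k)))"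
proof -
  have c: "U * mat_diag n d \<in> carrier_mat n n" using U by (simp add: mult_carrier_mat[of _ n n])
  have "(U * mat_diag n d) $$ (i, k) = U $$ (i, k) * d k" if "k < n" for k
    using that ij by (simp add: mat_diag_mult_right[OF U])
  then show ?thesis
    using ij by (simp add: index_mult_sum[OF c adjoint_carrier_rect[OF U]] index_adjoint[OF U])
qed

lemma unitary_diag_eqI:
  assumes U: "U \<in> carrier_mat n n" and A: "A \<in> carrier_mat n n"
    and "\<And>i j. i < n \<Longrightarrow> j < n \<Longrightarrow> A $$ (i, j) = (\<Sum>k<n. U $$ (i, k) * d k * cnj (U $$ (j, k)))"
  shows "A = U * mat_diag n d * mat_adjoint U"
  by (rule eq_matI) (use assms adjoint_carrier_rect[OF U] in \<open>auto simp: index_unitary_diag simp del: index_mult_mat(1)\<close>)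

lemma hermitian_matD: "hermitian_mat n A \<Longrightarrow> i < n \<Longrightarrow> j < n \<Longrightarrow> A $$ (i, j) = cnj (A $$ (j, i))"
  unfolding hermitian_mat_def by (metis index_adjoint)

lemma hermitian_matI:
  assumes A: "A \<in> carrier_mat n n" and h: "\<And>i j. i < n \<Longrightarrow> j < n \<Longrightarrow> A $$ (i, j) = cnj (A $$ (j, i))"
  shows "hermitian_mat n A"
proof -
  have "mat_adjoint A = A"
  proof (rule eq_matI)
    fix i j assume "i < dim_row A" "j < dim_col A"
    then have ij: "i < n" "j < n" using A by auto
    show "mat_adjoint A $$ (i, j) = A $$ (i, j)"
      unfolding index_adjoint[OF A ij] using h[OF ij] by simp
  qed (use A in auto)
  with A show ?thesis by (simp add: hermitian_mat_def)
qed

text \<open>The reflection 1 - 2 u u* / |u|^2 exchanges the first basis vector with w = c v, where u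
  is their difference. Being Hermitian and unitary, \<open>H\<close> is its own inverse, so
  conjugation by it is simply \<open>H * A * H\<close>.\<close>

lemma householder:
  fixes v :: "nat \<Rightarrow> complex"
  assumes n: "0 < n" and v: "(\<Sum>i<n. v i * cnj (v i)) = 1"
  obtains H c where "unitary_mat n H" "hermitian_mat n H" "c \<noteq> 0" "\<And>i. i < n \<Longrightarrow> H $$ (i, 0) = c * v i"
proof -
  \<comment> \<open>The phase makes \<open>w 0\<close> equal to - |v 0|. A reflection can carry the
    first basis vector to w only if their inner product is real, and the negative sign keeps u away
    from 0 even if v is a multiple of that basis vector.\<close>
  define c where "c = (if v 0 = 0 then 1 else - cnj (v 0) / cmod (v 0))"
  define r where "r = cmod (v 0)"
  have cc: "c * cnj c = 1"
  proof (cases "v 0 = 0")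
    case False
    have "v 0 * cnj (v 0) = complex_of_real (cmod (v 0)) * complex_of_real (cmod (v 0))"
      by (metis complex_norm_square power2_eq_square of_real_power)
    with False show ?thesis by (simp add: c_def field_simps)
  qed (simp add: c_def)
  then have c0: "c \<noteq> 0" by auto
  define w where "w i = c * v i" for i
  have w0: "w 0 = - complex_of_real r"
  proof (cases "v 0 = 0")
    case False
    have "v 0 * cnj (v 0) = complex_of_real (cmod (v 0)) * complex_of_real (cmod (v 0))"
      by (metis complex_norm_square power2_eq_square of_real_power)
    with False show ?thesis by (simp add: w_def r_def c_def field_simps)
  qed (simp add: w_def r_def)
  have sw: "(\<Sum>i<n. w i * cnj (w i)) = 1"
  proof -
    have "(\<Sum>i<n. w i * cnj (w i)) = (\<Sum>i<n. (c * cnj c) * (v i * cnj (v i)))"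
      by (simp add: w_def mult_ac)
    also have "\<dots> = 1" using v cc by simp
    finally show ?thesis .
  qed
  define u where "u i = w i - (if i = 0 then 1 else 0)" for i
  have r0: "r \<ge> 0" by (simp add: r_def)
  have r1: "1 + complex_of_real r \<noteq> 0"
    by (metis Re_complex_of_real add_cancel_left_right add_nonneg_pos less_numeral_extra(1,3) of_real_0 of_real_1 of_real_add add.commute r0)
  have su: "(\<Sum>i<n. cnj (u i) * u i) = 2 * (1 + complex_of_real r)"
  proof -
    have "cnj (u i) * u i = w i * cnj (w i) + (if i = 0 then 1 + 2 * complex_of_real r else 0)" for i
      by (simp add: u_def w0 algebra_simps)
    then have "(\<Sum>i<n. cnj (u i) * u i) = 1 + (1 + 2 * complex_of_real r)"
      using n by (simp add: sum.distrib sw)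
    then show ?thesis by simp
  qed
  \<comment> \<open>By \<open>su\<close> the denominator is half of |u|^2.\<close>
  define H where "H = Matrix.mat n n (\<lambda>(i, j). (if i = j then 1 else 0) - u i * cnj (u j) / (1 + complex_of_real r))"
  have H: "H \<in> carrier_mat n n" by (simp add: H_def)
  have herm: "hermitian_mat n H"
    by (rule hermitian_matI[OF H]) (auto simp: H_def mult.commute)
  have uni: "unitary_mat n H"
  proof (rule unitary_matI_left[OF H])
    fix i j assume ij: "i < n" "j < n"
    let ?s = "1 + complex_of_real r"
    have "(\<Sum>k<n. cnj (H $$ (k, i)) * H $$ (k, j)) =
      (\<Sum>k<n. (if k = i then (if i = j then 1 else 0) else 0) - (if k = i then u i * cnj (u j) / ?s else 0)
        - (if k = j then u i * cnj (u j) / ?s else 0)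
        + u i * cnj (u j) / ?s\<^sup>2 * (cnj (u k) * u k))"
      using ij by (intro sum.cong) (auto simp: H_def algebra_simps power2_eq_square)
    also have "\<dots> = (if i = j then 1 else 0) - 2 * (u i * cnj (u j) / ?s) + u i * cnj (u j) / ?s\<^sup>2 * (2 * ?s)"
      unfolding sum.distrib sum_subtractf sum_distrib_left[symmetric] su using ij by simp
    also have "\<dots> = (if i = j then 1 else 0)"
    proof -
      have "x / ?s\<^sup>2 * (2 * ?s) = 2 * (x / ?s)" for x
        using r1 by (simp add: power2_eq_square del: distrib_left_numeral)
      then show ?thesis by simp
    qed
    finally show "(\<Sum>k<n. cnj (H $$ (k, i)) * H $$ (k, j)) = (if i = j then 1 else 0)" .
  qed
  have "H $$ (i, 0) = c * v i" if "i < n" for i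
  proof -
    have u0: "cnj (u 0) / (1 + complex_of_real r) = - 1" using r1 by (simp add: u_def w0 divide_simps)
    have "H $$ (i, 0) = (if i = 0 then 1 else 0) - u i * (cnj (u 0) / (1 + complex_of_real r))"
      using that n by (simp add: H_def)
    then have "H $$ (i, 0) = (if i = 0 then 1 else 0) + u i"
      unfolding u0 by simp
    then show ?thesis by (simp add: u_def w_def)
  qed
  with uni herm c0 show ?thesis by (rule that)
qed

text \<open>Deflation: the reflection moves an eigenvector to the first coordinate. The first column
  of H A H is then zero off the diagonal, by symmetry so is its first row, and the induction
  hypothesis applies to the remaining block.\<close>

theorem hermitian_spectral:
  "hermitian_mat n A \<Longrightarrow> \<exists>U (d :: nat \<Rightarrow> real). unitary_mat n U \<and>
     A = U * mat_diag n (\<lambda>i. complex_of_real (d i)) * mat_adjoint U"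
proof (induction n arbitrary: A)
  case 0
  then have A: "A \<in> carrier_mat 0 0" by (simp add: hermitian_mat_def)
  have 1: "unitary_mat 0 (1\<^sub>m 0 :: complex mat)" by (rule unitary_matI_left) auto
  have "A = 1\<^sub>m 0 * mat_diag 0 (\<lambda>i. complex_of_real 0) * mat_adjoint (1\<^sub>m 0)"
    by (rule unitary_diag_eqI) (use A in auto)
  with 1 show ?case by (intro exI[of _ "1\<^sub>m 0"] exI[of _ "\<lambda>_. 0"]) auto
next
  case (Suc n)
  let ?N = "Suc n"
  have A: "A \<in> carrier_mat ?N ?N" and adj: "mat_adjoint A = A" using Suc.prems by (auto simp: hermitian_mat_def)
  obtain k where "eigenvalue A k"
    using spectrum_non_empty[OF A] by (auto simp: spectrum_def)
  then obtain v where v: "v \<in> carrier_vec ?N" "v \<noteq> 0\<^sub>v ?N" and Av: "A *\<^sub>v v = k \<cdot>\<^sub>v v"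
    using A by (auto simp: eigenvalue_def eigenvector_def)
  define s where "s = (\<Sum>i<?N. (cmod (v $ i))\<^sup>2)"
  have "s \<noteq> 0"
  proof
    assume "s = 0"
    then have "\<forall>i<?N. v $ i = 0" by (auto simp: s_def sum_nonneg_eq_0_iff simp del: sum.lessThan_Suc)
    then have "v = 0\<^sub>v ?N" using v(1) by (intro eq_vecI) auto
    with v(2) show False by simp
  qed
  moreover have "s \<ge> 0" by (simp add: s_def sum_nonneg)
  ultimately have s: "s > 0" by simp
  define w where "w i = v $ i / complex_of_real (sqrt s)" for i
  have "(\<Sum>i<?N. w i * cnj (w i)) = 1"
  proof -
    have "w i * cnj (w i) = complex_of_real ((cmod (v $ i))\<^sup>2) / complex_of_real s" for i
      using s by (simp add: w_def complex_norm_square del: of_real_power flip: of_real_mult)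
    then have "(\<Sum>i<?N. w i * cnj (w i)) = complex_of_real s / complex_of_real s"
      unfolding s_def by (simp flip: sum_divide_distrib)
    then show ?thesis using s by simp
  qed
  then obtain H c where H: "unitary_mat ?N H" "hermitian_mat ?N H" "c \<noteq> 0"
    and H0: "\<And>i. i < ?N \<Longrightarrow> H $$ (i, 0) = c * w i"
    using householder[of ?N w] by (metis zero_less_Suc)
  have Hc: "H \<in> carrier_mat ?N ?N" and Hadj: "mat_adjoint H = H" using H(2) by (auto simp: hermitian_mat_def)
  have HH: "H * H = 1\<^sub>m ?N" using H(1) Hadj by (simp add: unitary_mat_def)
  note [simp] = mult_carrier_mat[of _ ?N ?N _ ?N]
  define B where "B = H * A * H"
  have B: "B \<in> carrier_mat ?N ?N" using A Hc by (simp add: B_def)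
  have "mat_adjoint B = B"
    using A Hc by (simp add: B_def adjoint_mult[of _ ?N ?N _ ?N] Hadj adj assoc_mult_mat[of _ ?N ?N _ ?N _ ?N])
  then have Bh: "hermitian_mat ?N B" using B by (simp add: hermitian_mat_def)
  have AH0: "(A * H) $$ (i, 0) = k * H $$ (i, 0)" if "i < ?N" for i
  proof -
    have "(A * H) $$ (i, 0) = (\<Sum>l<?N. A $$ (i, l) * v $ l) * c / complex_of_real (sqrt s)"
      using that by (simp add: index_mult_sum[OF A Hc] H0 w_def sum_distrib_left sum_distrib_right sum_divide_distrib mult_ac del: sum.lessThan_Suc)
    also have "(\<Sum>l<?N. A $$ (i, l) * v $ l) = k * v $ i"
      unfolding index_mult_vec_sum[OF A v(1) that, symmetric] Av using that v(1) by simp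
    finally show ?thesis using that by (simp add: H0 w_def)
  qed
  have B0: "B $$ (i, 0) = (if i = 0 then k else 0)" if "i < ?N" for i
  proof -
    have "B $$ (i, 0) = (H * (A * H)) $$ (i, 0)"
      using A Hc by (simp add: B_def assoc_mult_mat[of _ ?N ?N _ ?N _ ?N])
    also have "\<dots> = (\<Sum>l<?N. H $$ (i, l) * (k * H $$ (l, 0)))"
      using that A Hc by (subst index_mult_sum[of _ ?N ?N _ ?N]) (auto simp: AH0 simp del: index_mult_mat(1) sum.lessThan_Suc)
    also have "\<dots> = k * (H * H) $$ (i, 0)"
      using that by (simp add: index_mult_sum[OF Hc Hc] sum_distrib_left mult_ac del: sum.lessThan_Suc)
    finally show ?thesis using that by (simp add: HH)
  qed
  \<comment> \<open>The eigenvalue is a diagonal entry of a Hermitian matrix, hence real.\<close>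
  have kr: "cnj k = k" using hermitian_matD[OF Bh, of 0 0] B0[of 0] by (metis zero_less_Suc)
  then have kr': "complex_of_real (Re k) = k" by (simp add: complex_eq_iff)
  have B0': "B $$ (0, i) = (if i = 0 then k else 0)" if "i < ?N" for i
  proof -
    have "B $$ (0, i) = cnj (B $$ (i, 0))" by (rule hermitian_matD[OF Bh _ that]) simp
    then show ?thesis unfolding B0[OF that] using kr by simp
  qed
  define B' where "B' = Matrix.mat n n (\<lambda>(i, j). B $$ (Suc i, Suc j))"
  have B'c: "B' \<in> carrier_mat n n" by (simp add: B'_def)
  have "hermitian_mat n B'"
  proof (rule hermitian_matI[OF B'c])
    fix i j assume "i < n" "j < n"
    then show "B' $$ (i, j) = cnj (B' $$ (j, i))"
      using hermitian_matD[OF Bh, of "Suc i" "Suc j"] by (simp only: B'_def index_mat) simp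
  qed
  from Suc.IH[OF this] obtain U' d' where U': "unitary_mat n U'"
    and B'U: "B' = U' * mat_diag n (\<lambda>i. complex_of_real (d' i)) * mat_adjoint U'" by blast
  have U'c: "U' \<in> carrier_mat n n" using U' by (simp add: unitary_mat_def)
  have B'i: "B $$ (Suc i, Suc j) = (\<Sum>k<n. U' $$ (i, k) * d' k * cnj (U' $$ (j, k)))" if "i < n" "j < n" for i j
    unfolding index_unitary_diag[OF U'c that, symmetric] B'U[symmetric] using that by (simp add: B'_def)
  \<comment> \<open>The block sum of 1 and \<open>U'\<close>, whence the shifted indices.\<close>
  define F where "F = Matrix.mat ?N ?N (\<lambda>(i, j). if i = 0 then (if j = 0 then 1 else 0)
    else if j = 0 then 0 else U' $$ (i - 1, j - 1))"
  define d where "d i = (if i = 0 then Re k else d' (i - 1))" for i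
  have F: "F \<in> carrier_mat ?N ?N" by (simp add: F_def)
  have Fu: "unitary_mat ?N F"
  proof (rule unitary_matI_left[OF F])
    fix i j assume "i < ?N" "j < ?N"
    then show "(\<Sum>k<?N. cnj (F $$ (k, i)) * F $$ (k, j)) = (if i = j then 1 else 0)"
      using unitary_columns[OF U', of "i - 1" "j - 1"]
      by (cases i; cases j) (auto simp: F_def sum.lessThan_Suc_shift simp del: sum.lessThan_Suc)
  qed
  have BF: "B = F * mat_diag ?N (\<lambda>i. complex_of_real (d i)) * mat_adjoint F"
  proof (rule unitary_diag_eqI[OF F B])
    fix i j assume ij: "i < ?N" "j < ?N"
    show "B $$ (i, j) = (\<Sum>k<?N. F $$ (i, k) * complex_of_real (d k) * cnj (F $$ (j, k)))"
      using ij B0[OF ij(1)] B0'[OF ij(2)] B'i[of "i - 1" "j - 1"] kr'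
      by (cases i; cases j) (auto simp: F_def d_def sum.lessThan_Suc_shift simp del: sum.lessThan_Suc)
  qed
  define U where "U = H * F"
  have Fadj: "mat_adjoint F \<in> carrier_mat ?N ?N" using F by simp
  have FF: "F * mat_adjoint F = 1\<^sub>m ?N" "mat_adjoint F * F = 1\<^sub>m ?N" using Fu by (auto simp: unitary_mat_def)
  have Uc: "U \<in> carrier_mat ?N ?N" using F Hc by (simp add: U_def)
  have Uadj: "mat_adjoint U = mat_adjoint F * H" using F Hc by (simp add: U_def adjoint_mult[of _ ?N ?N _ ?N] Hadj)
  have "U * mat_adjoint U = H * ((F * mat_adjoint F) * H)"
    unfolding Uadj unfolding U_def using F Hc Fadj by (simp only: assoc_mult_mat[of _ ?N ?N _ ?N _ ?N] mult_carrier_mat[of _ ?N ?N _ ?N])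
  also have "\<dots> = 1\<^sub>m ?N" by (simp only: FF left_mult_one_mat[OF Hc] HH)
  finally have U1: "U * mat_adjoint U = 1\<^sub>m ?N" .
  have Uu: "unitary_mat ?N U"
    using U1 Uc mat_mult_left_right_inverse[OF Uc adjoint_carrier_rect[OF Uc] U1] by (simp add: unitary_mat_def)
  have HHX: "H * (H * X) = X" if "X \<in> carrier_mat ?N ?N" for X
    using that assoc_mult_mat[OF Hc Hc that] by (simp only: HH left_mult_one_mat)
  have "H * B * H = H * (H * (A * (H * H)))"
    unfolding B_def using A Hc by (simp only: assoc_mult_mat[of _ ?N ?N _ ?N _ ?N] mult_carrier_mat[of _ ?N ?N _ ?N])
  also have "\<dots> = A" using A Hc by (simp only: HHX HH right_mult_one_mat mult_carrier_mat[of _ ?N ?N _ ?N])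
  finally have "A = H * B * H" by (rule sym)
  also have "\<dots> = U * mat_diag ?N (\<lambda>i. complex_of_real (d i)) * mat_adjoint U"
    unfolding BF Uadj unfolding U_def using F Hc Fadj
    by (simp only: assoc_mult_mat[of _ ?N ?N _ ?N _ ?N] mult_carrier_mat[of _ ?N ?N _ ?N] mat_diag_dim)
  finally show ?case using Uu by blast
qed

section \<open>Jensen's operator inequality\<close>

lemma cscalar_adjoint:
  fixes A :: "complex mat"
  assumes A: "A \<in> carrier_mat n m" and x: "x \<in> carrier_vec m" and y: "y \<in> carrier_vec n"
  shows "(A *\<^sub>v x) \<bullet>c y = x \<bullet>c (mat_adjoint A *\<^sub>v y)"
proof -
  have Ax: "A *\<^sub>v x \<in> carrier_vec n" and Ay: "mat_adjoint A *\<^sub>v y \<in> carrier_vec m"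
    using mult_mat_vec_carrier[OF A x] mult_mat_vec_carrier[OF adjoint_carrier_rect[OF A] y] .
  have "(A *\<^sub>v x) \<bullet>c y = (\<Sum>i<n. \<Sum>j<m. A $$ (i, j) * x $ j * cnj (y $ i))"
    unfolding cscalar_prod_sum[OF Ax y]
    by (intro sum.cong refl) (simp add: index_mult_vec_sum[OF A x] sum_distrib_right del: index_mult_mat_vec)
  also have "\<dots> = (\<Sum>j<m. \<Sum>i<n. A $$ (i, j) * x $ j * cnj (y $ i))" by (rule sum.swap)
  also have "\<dots> = x \<bullet>c (mat_adjoint A *\<^sub>v y)"
    unfolding cscalar_prod_sum[OF x Ay]
    by (intro sum.cong refl) (simp add: index_mult_vec_sum[OF adjoint_carrier_rect[OF A] y]
        index_adjoint[OF A] sum_distrib_left mult_ac del: index_mult_mat_vec)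
  finally show ?thesis .
qed

lemma quadratic_form_unitary_diag:
  assumes U: "U \<in> carrier_mat n n" and v: "v \<in> carrier_vec n"
  shows "Re ((U * mat_diag n (\<lambda>i. complex_of_real (d i)) * mat_adjoint U *\<^sub>v v) \<bullet>c v)
       = (\<Sum>k<n. d k * (cmod ((mat_adjoint U *\<^sub>v v) $ k))\<^sup>2)"
proof -
  let ?D = "mat_diag n (\<lambda>i. complex_of_real (d i))"
  define w where "w = mat_adjoint U *\<^sub>v v"
  have w: "w \<in> carrier_vec n" unfolding w_def by (rule mult_mat_vec_carrier[OF adjoint_carrier_rect[OF U] v])
  have Dw: "?D *\<^sub>v w \<in> carrier_vec n" using w by (metis mat_diag_dim mult_mat_vec_carrier)
  have Dwi: "(?D *\<^sub>v w) $ i = d i * w $ i" if "i < n" for i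
    unfolding index_mult_vec_sum[OF mat_diag_dim w that]
    using that by (simp add: mat_diag_def if_distrib[of "\<lambda>x. x * _"] cong: if_cong)
  have "U * ?D * mat_adjoint U *\<^sub>v v = U *\<^sub>v (?D *\<^sub>v w)"
    using assoc_mult_mat_vec[of "U * ?D" n n "mat_adjoint U" n v] assoc_mult_mat_vec[of U n n ?D n w] U v w
    by (simp add: w_def mult_carrier_mat[of _ n n _ n])
  then have "(U * ?D * mat_adjoint U *\<^sub>v v) \<bullet>c v = (?D *\<^sub>v w) \<bullet>c w"
    using cscalar_adjoint[OF U Dw v] by (simp add: w_def)
  also have "\<dots> = (\<Sum>i<n. complex_of_real (d i * (cmod (w $ i))\<^sup>2))"
    unfolding cscalar_prod_sum[OF Dw w]
    by (intro sum.cong refl) (simp add: Dwi complex_norm_square[unfolded of_real_power] mult_ac del: index_mult_mat_vec)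
  finally show ?thesis by (simp add: w_def)
qed

lemma quadratic_form_combination:
  assumes "A \<in> carrier_mat n n" "B \<in> carrier_mat n n" "C \<in> carrier_mat n n" and v: "v \<in> carrier_vec n"
  shows "Re (((mat_combination \<mu> A B - C) *\<^sub>v v) \<bullet>c v)
    = \<mu> * Re ((A *\<^sub>v v) \<bullet>c v) + (1 - \<mu>) * Re ((B *\<^sub>v v) \<bullet>c v) - Re ((C *\<^sub>v v) \<bullet>c v)"
proof -
  have q: "(X *\<^sub>v v) \<bullet>c v = (\<Sum>i<n. \<Sum>j<n. X $$ (i, j) * v $ j * cnj (v $ i))"
    if X: "X \<in> carrier_mat n n" for X
  proof -
    have "X *\<^sub>v v \<in> carrier_vec n" using X v by auto
    then show ?thesis
      unfolding cscalar_prod_sum[OF \<open>X *\<^sub>v v \<in> carrier_vec n\<close> v]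
      by (intro sum.cong refl) (simp add: index_mult_vec_sum[OF X v] sum_distrib_right del: index_mult_mat_vec)
  qed
  have c: "mat_combination \<mu> A B - C \<in> carrier_mat n n" using assms by (simp add: mat_combination_def minus_carrier_mat)
  have "((mat_combination \<mu> A B - C) *\<^sub>v v) \<bullet>c v =
     complex_of_real \<mu> * ((A *\<^sub>v v) \<bullet>c v) + complex_of_real (1 - \<mu>) * ((B *\<^sub>v v) \<bullet>c v) - ((C *\<^sub>v v) \<bullet>c v)"
    unfolding q[OF c] q[OF assms(1)] q[OF assms(2)] q[OF assms(3)] sum_distrib_left
      sum.distrib[symmetric] sum_subtractf[symmetric]
    using assms by (intro sum.cong refl) (auto simp: mat_combination_def algebra_simps)
  then show ?thesis by simp
qed

section \<open>Spectra and functions of Hermitian matrices\<close>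

lemma spectrum_unitary_diag:
  assumes U: "unitary_mat n U"
  shows "spectrum (U * mat_diag n d * mat_adjoint U) = d ` {..<n}"
proof -
  let ?D = "mat_diag n d" let ?A = "U * ?D * mat_adjoint U"
  have Uc: "U \<in> carrier_mat n n" using U by (simp add: unitary_mat_def)
  have A: "?A \<in> carrier_mat n n" using Uc by (simp add: mult_carrier_mat[of _ n n _ n])
  have "similar_mat_wit ?A ?D U (mat_adjoint U)"
    using U Uc A by (intro similar_mat_witI[of _ _ n]) (auto simp: unitary_mat_def)
  then have "char_poly ?A = char_poly ?D"
    by (intro char_poly_similar) (auto simp: similar_mat_def)
  also have "\<dots> = (\<Prod>a\<leftarrow>diag_mat ?D. [:- a, 1:])"
    by (rule char_poly_upper_triangular[of _ n]) (auto simp: upper_triangular_def mat_diag_def)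
  also have "diag_mat ?D = map d [0..<n]"
    by (auto simp: diag_mat_def mat_diag_def)
  finally have "char_poly ?A = (\<Prod>a\<leftarrow>map d [0..<n]. [:- a, 1:])" .
  then show ?thesis
    unfolding spectrum_root_char_poly[OF A]
    by (auto simp: poly_prod_list prod_list_zero_iff image_iff lessThan_atLeast0)
qed

lemma mat_fun_hermitian_carrier:
  assumes "hermitian_mat n A"
  shows "mat_real_fun f A \<in> carrier_mat n n"
proof -
  obtain U d where U: "unitary_mat n U" and A: "A = U * mat_diag n (\<lambda>i. complex_of_real (d i)) * mat_adjoint U"
    using hermitian_spectral[OF assms] by blast
  then show ?thesis
    by (auto simp: mat_fun_unitary_diag unitary_mat_def mult_carrier_mat[of _ n n _ n])
qed

lemma hermitian_unitary_diag:
  assumes U: "U \<in> carrier_mat n n"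
  shows "hermitian_mat n (U * mat_diag n (\<lambda>i. complex_of_real (d i)) * mat_adjoint U)"
  by (rule hermitian_matI)
    (use U in \<open>auto simp: mult_carrier_mat[of _ n n _ n] index_unitary_diag mult_ac simp del: index_mult_mat(1)\<close>)

lemma hermitian_combination:
  assumes "hermitian_mat n A" "hermitian_mat n B"
  shows "hermitian_mat n (mat_combination \<mu> A B)"
proof (rule hermitian_matI)
  have c: "A \<in> carrier_mat n n" "B \<in> carrier_mat n n" using assms by (auto simp: hermitian_mat_def)
  then show "mat_combination \<mu> A B \<in> carrier_mat n n" by (simp add: mat_combination_def)
  fix i j assume ij: "i < n" "j < n"
  show "mat_combination \<mu> A B $$ (i, j) = cnj (mat_combination \<mu> A B $$ (j, i))"
    using ij c hermitian_matD[OF assms(1) ij(2,1)] hermitian_matD[OF assms(2) ij(2,1)]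
    by (simp add: mat_combination_def)
qed

text \<open>With T = W* X the hypothesis reads c_i T_ij = T_ij e_j, so T_ij vanishes unless c_i =
  e_j, and then f(c_i) = f(e_j). This gives a function of a matrix on an invariant subspace without
  an eigenbasis adapted to the subspace.\<close>

lemma unitary_diag_fun_intertwine:
  assumes W: "unitary_mat n W" and X: "X \<in> carrier_mat n m"
    and eq: "W * mat_diag n c * mat_adjoint W * X = X * mat_diag m e"
  shows "W * mat_diag n (\<lambda>i. f (c i)) * mat_adjoint W * X = X * mat_diag m (\<lambda>i. f (e i))"
proof -
  let ?W = "mat_adjoint W"
  have Wc: "W \<in> carrier_mat n n" "?W \<in> carrier_mat n n" and WW: "?W * W = 1\<^sub>m n" "W * ?W = 1\<^sub>m n"
    using W by (auto simp: unitary_mat_def)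
  define T where "T = ?W * X"
  have T: "T \<in> carrier_mat n m" unfolding T_def by (rule mult_carrier_mat[OF Wc(2) X])
  have WT: "W * T = X" unfolding T_def using assoc_mult_mat[OF Wc X] WW X by simp
  have WDX: "W * mat_diag n g * ?W * X = W * (mat_diag n g * T)" for g
    using Wc X by (simp add: T_def assoc_mult_mat[of _ n n _ n _ n] assoc_mult_mat[of _ n n _ n _ m] mult_carrier_mat[of _ n n _ n])
  have DT: "mat_diag n g * T \<in> carrier_mat n m" "T * mat_diag m h \<in> carrier_mat n m" for g h
    using T by (meson mat_diag_dim mult_carrier_mat)+
  have "mat_diag n c * T = ?W * (W * (mat_diag n c * T))"
    using assoc_mult_mat[OF Wc(2,1) DT(1)] WW left_mult_one_mat[OF DT(1)] by simp
  also have "\<dots> = ?W * (X * mat_diag m e)" using eq by (simp add: WDX)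
  also have "\<dots> = T * mat_diag m e" unfolding T_def using assoc_mult_mat[OF Wc(2) X mat_diag_dim] by simp
  finally have c: "mat_diag n c * T = T * mat_diag m e" .
  have "mat_diag n (\<lambda>i. f (c i)) * T = T * mat_diag m (\<lambda>i. f (e i))"
  proof (rule eq_matI)
    fix i j assume "i < dim_row (T * mat_diag m (\<lambda>i. f (e i)))" "j < dim_col (T * mat_diag m (\<lambda>i. f (e i)))"
    then have ij: "i < n" "j < m" using T by (auto simp: mat_diag_def)
    have "(mat_diag n c * T) $$ (i, j) = (T * mat_diag m e) $$ (i, j)" by (simp only: c)
    then have "c i * T $$ (i, j) = T $$ (i, j) * e j"
      using ij by (simp add: mat_diag_mult_left[OF T] mat_diag_mult_right[OF T])
    then have "T $$ (i, j) = 0 \<or> c i = e j" by auto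
    then show "(mat_diag n (\<lambda>i. f (c i)) * T) $$ (i, j) = (T * mat_diag m (\<lambda>i. f (e i))) $$ (i, j)"
      using ij by (auto simp: mat_diag_mult_left[OF T] mat_diag_mult_right[OF T])
  qed (use T in \<open>auto simp: mat_diag_def\<close>)
  then show ?thesis
    unfolding WDX using assoc_mult_mat[OF Wc(1) T mat_diag_dim] by (simp add: WT)
qed

text \<open>With the reflection \<open>R = 2 V V\<^sup>* - 1\<close>, the average of \<open>A = diag d\<close> and \<open>R A R\<close> leaves the range of
  \<open>V\<close> invariant and acts there as \<open>diag e\<close>, so operator convexity can be tested on vectors \<open>V x = R V x\<close>.\<close>

lemma operator_jensen_nat:
  fixes V :: "nat \<Rightarrow> nat \<Rightarrow> complex" and d e :: "nat \<Rightarrow> real" and x :: "nat \<Rightarrow> complex"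
  assumes convex: "operator_convex_on I f" and d: "\<And>k. k < N \<Longrightarrow> d k \<in> I"
    and isom: "\<And>l m. l < M \<Longrightarrow> m < M \<Longrightarrow> (\<Sum>k<N. cnj (V k l) * V k m) = (if l = m then 1 else 0)"
    and compress: "\<And>l m. l < M \<Longrightarrow> m < M \<Longrightarrow>
      (\<Sum>k<N. cnj (V k l) * d k * V k m) = (if l = m then complex_of_real (e l) else 0)"
  shows "(\<Sum>l<M. f (e l) * (cmod (x l))\<^sup>2) \<le> (\<Sum>k<N. f (d k) * (cmod (\<Sum>l<M. V k l * x l))\<^sup>2)"
proof -
  let ?diag = "\<lambda>n g. mat_diag n (\<lambda>i. complex_of_real (g i))"
  define S where "S = Matrix.mat N M (\<lambda>(k, l). V k l)"
  define T where "T = mat_adjoint S"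
  have S: "S \<in> carrier_mat N M" by (simp add: S_def)
  then have T: "T \<in> carrier_mat M N" by (simp add: T_def)
  have Ti: "T $$ (l, k) = cnj (V k l)" if "l < M" "k < N" for l k
    using that by (simp add: T_def index_adjoint[OF S]) (simp add: S_def)
  have TS: "T * S = 1\<^sub>m M"
  proof (rule eq_matI)
    fix i j assume "i < dim_row (1\<^sub>m M)" "j < dim_col (1\<^sub>m M)"
    then have ij: "i < M" "j < M" by auto
    show "(T * S) $$ (i, j) = 1\<^sub>m M $$ (i, j)"
      unfolding index_mult_sum[OF T S ij] using ij isom[OF ij] by (simp add: Ti S_def)
  qed (use T S in auto)
  define A where "A = ?diag N d"
  have A: "A \<in> carrier_mat N N" by (simp add: A_def)
  have AS: "A * S \<in> carrier_mat N M" using A S by simp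
  have ASi: "(A * S) $$ (k, l) = d k * V k l" if "k < N" "l < M" for k l
    using that by (simp add: A_def mat_diag_mult_left[OF S]) (simp add: S_def)
  have TAS: "T * (A * S) = ?diag M e"
  proof (rule eq_matI)
    fix i j assume "i < dim_row (?diag M e)" "j < dim_col (?diag M e)"
    then have ij: "i < M" "j < M" by (auto simp: mat_diag_def)
    show "(T * (A * S)) $$ (i, j) = ?diag M e $$ (i, j)"
      unfolding index_mult_sum[OF T AS ij] using ij compress[OF ij]
      by (simp add: Ti ASi mult_ac mat_diag_def del: index_mult_mat(1))
  qed (use T A S in \<open>auto simp: mat_diag_def\<close>)
  define P where "P = S * T"
  have P: "P \<in> carrier_mat N N" using S T by (simp add: P_def)
  \<comment> \<open>\<open>P\<close> is the projection onto the range of \<open>V\<close>, so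
    \<open>R\<close> is 1 there and -1 on the orthogonal complement.\<close>
  define R where "R = 2 \<cdot>\<^sub>m P - 1\<^sub>m N"
  have R: "R \<in> carrier_mat N N" using P by (simp add: R_def minus_carrier_mat)
  have Radj: "mat_adjoint R = R"
  proof -
    have "mat_adjoint P = P" using S T by (simp add: P_def adjoint_mult[OF S T]) (simp add: T_def adjoint_adjoint[OF S])
    then have "hermitian_mat N P" using P by (simp add: hermitian_mat_def)
    have "hermitian_mat N R"
    proof (rule hermitian_matI[OF R])
      fix i j assume ij: "i < N" "j < N"
      show "R $$ (i, j) = cnj (R $$ (j, i))"
        using ij P hermitian_matD[OF \<open>hermitian_mat N P\<close> ij(2,1)] by (simp add: R_def)
    qed
    then show ?thesis by (simp add: hermitian_mat_def)
  qed
  have RX: "R * X = 2 \<cdot>\<^sub>m (P * X) - X" if X: "X \<in> carrier_mat N m" for X m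
    unfolding R_def using P X minus_mult_distrib_mat[of "2 \<cdot>\<^sub>m P" N N "1\<^sub>m N" X m] mult_smult_assoc_mat[OF P X] by simp
  have PX: "P * X = S * (T * X)" if X: "X \<in> carrier_mat N m" for X m
    unfolding P_def by (rule assoc_mult_mat[OF S T X])
  have RS: "R * S = S"
    unfolding RX[OF S] PX[OF S] TS using S by (intro eq_matI) auto
  then have TR: "T * R = T"
    using adjoint_mult[OF R S] by (simp add: Radj T_def)
  have RR: "R * R = 1\<^sub>m N"
    unfolding RX[OF R] PX[OF R] TR P_def[symmetric] using P by (intro eq_matI) (auto simp: R_def)
  have Ru: "unitary_mat N R" using R RR by (simp add: unitary_mat_def Radj)
  have adj1: "mat_adjoint (1\<^sub>m N :: complex mat) = 1\<^sub>m N"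
    by (rule eq_matI) (auto simp: index_adjoint[of _ N N])
  have 1: "unitary_mat N (1\<^sub>m N)" by (simp add: unitary_mat_def adj1)
  have diag1: "1\<^sub>m N * ?diag N g * mat_adjoint (1\<^sub>m N) = ?diag N g" for g :: "nat \<Rightarrow> real"
    by (simp add: adj1 left_mult_one_mat[of _ N N] right_mult_one_mat[of _ N N])
  define B where "B = R * ?diag N d * mat_adjoint R"
  have B: "B \<in> carrier_mat N N" using R by (simp add: B_def mult_carrier_mat[of _ N N _ N])
  have hA: "hermitian_mat N A" using hermitian_unitary_diag[of "1\<^sub>m N" N d] by (simp add: diag1 A_def)
  have hB: "hermitian_mat N B" unfolding B_def by (rule hermitian_unitary_diag[OF R])
  define C where "C = mat_combination (1/2) A B"
  have hC: "hermitian_mat N C" unfolding C_def by (rule hermitian_combination[OF hA hB])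
  \<comment> \<open>Since \<open>R\<close> fixes the range, B S = R A S = 2 P A S - A S, and P A S =
    S (T A S) = S diag e.\<close>
  have BS: "B * S = 2 \<cdot>\<^sub>m (S * ?diag M e) - A * S"
  proof -
    have "B * S = R * (A * (R * S))"
      unfolding B_def Radj A_def[symmetric] using R A S
      by (simp add: assoc_mult_mat[of _ N N _ N _ N] assoc_mult_mat[of _ N N _ N _ M] mult_carrier_mat[of _ N N _ N])
    then show ?thesis unfolding RS RX[OF AS] PX[OF AS] TAS .
  qed
  \<comment> \<open>The two copies of \<open>A * S\<close> cancel in the average, and with them the
    part of A S that leaves the range.\<close>
  have CS: "C * S = S * ?diag M e"
  proof -
    have SE: "S * ?diag M e \<in> carrier_mat N M" using S by (meson mat_diag_dim mult_carrier_mat)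
    have "C * S = complex_of_real (1/2) \<cdot>\<^sub>m (A * S) + complex_of_real (1 - 1/2) \<cdot>\<^sub>m (B * S)"
      unfolding C_def mat_combination_def using A B S
      by (simp add: add_mult_distrib_mat[of _ N N _ _ M] mult_smult_assoc_mat[of _ N N _ M])
    also have "\<dots> = S * ?diag M e"
      unfolding BS using carrier_matD[OF AS] carrier_matD[OF SE]
      by (intro eq_matI) (auto simp: field_simps simp del: index_mult_mat)
    finally show ?thesis .
  qed
  obtain W c where W: "unitary_mat N W" and CW: "C = W * ?diag N c * mat_adjoint W"
    using hermitian_spectral[OF hC] by blast
  have fC: "mat_real_fun f C = W * ?diag N (\<lambda>k. f (c k)) * mat_adjoint W"
    unfolding CW mat_fun_unitary_diag[OF W] by simp
  have fA: "mat_real_fun f A = 1\<^sub>m N * ?diag N (\<lambda>k. f (d k)) * mat_adjoint (1\<^sub>m N)"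
    using mat_fun_unitary_diag[OF 1, of _ "\<lambda>k. complex_of_real (d k)"] by (simp add: diag1 A_def)
  have fB: "mat_real_fun f B = R * ?diag N (\<lambda>k. f (d k)) * mat_adjoint R"
    unfolding B_def mat_fun_unitary_diag[OF Ru] by simp
  have fCS: "mat_real_fun f C * S = S * ?diag M (\<lambda>l. f (e l))"
    using unitary_diag_fun_intertwine[OF W S, of "\<lambda>i. complex_of_real (c i)" "\<lambda>i. complex_of_real (e i)" "\<lambda>z. complex_of_real (f (Re z))"]
      CS by (simp add: fC flip: CW)
  have "spectrum A \<subseteq> complex_of_real ` I" "spectrum B \<subseteq> complex_of_real ` I"
    using d spectrum_unitary_diag[OF Ru, of "\<lambda>i. complex_of_real (d i)"]
      spectrum_unitary_diag[OF 1, of "\<lambda>i. complex_of_real (d i)"]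
    by (auto simp: diag1 A_def B_def)
  \<comment> \<open>Operator convexity enters here; the equal weights are those of the average with
    the reflected copy \<open>B\<close>.\<close>
  then have psd: "pos_semidef_mat N (mat_combination (1/2) (mat_real_fun f A) (mat_real_fun f B) - mat_real_fun f C)"
    using convex[unfolded operator_convex_on_def, rule_format, OF hA hB, of "1/2"] by (simp add: C_def)
  define X where "X = Matrix.vec M x"
  have X: "X \<in> carrier_vec M" by (simp add: X_def)
  define v where "v = S *\<^sub>v X"
  have v: "v \<in> carrier_vec N" using S X by (simp add: v_def)
  have vi: "v $ k = (\<Sum>l<M. V k l * x l)" if "k < N" for k
    unfolding v_def index_mult_vec_sum[OF S X that] using that by (simp add: S_def X_def)
  \<comment> \<open>Since v is fixed by \<open>R\<close>, the matrices f(A) and f(B) = R f(A) R have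
    the same quadratic form at v.\<close>
  have Rv: "R *\<^sub>v v = v" unfolding v_def using assoc_mult_mat_vec[OF R S X] RS by simp
  have qA: "Re ((mat_real_fun f A *\<^sub>v v) \<bullet>c v) = (\<Sum>k<N. f (d k) * (cmod (v $ k))\<^sup>2)"
    unfolding fA quadratic_form_unitary_diag[OF one_carrier_mat v] using v by (simp add: adj1)
  have qB: "Re ((mat_real_fun f B *\<^sub>v v) \<bullet>c v) = (\<Sum>k<N. f (d k) * (cmod (v $ k))\<^sup>2)"
    unfolding fB quadratic_form_unitary_diag[OF R v] by (simp add: Radj Rv)
  have qC: "Re ((mat_real_fun f C *\<^sub>v v) \<bullet>c v) = (\<Sum>l<M. f (e l) * (cmod (x l))\<^sup>2)"
  proof -
    define Y where "Y = ?diag M (\<lambda>l. f (e l)) *\<^sub>v X"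
    have Y: "Y \<in> carrier_vec M" unfolding Y_def using X by (metis mat_diag_dim mult_mat_vec_carrier)
    have Yi: "Y $ l = f (e l) * x l" if "l < M" for l
      unfolding Y_def index_mult_vec_sum[OF mat_diag_dim X that]
      using that by (simp add: mat_diag_def X_def if_distrib[of "\<lambda>x. x * _"] cong: if_cong)
    have "mat_real_fun f C *\<^sub>v v = S *\<^sub>v Y"
      unfolding v_def Y_def assoc_mult_mat_vec[OF mat_fun_hermitian_carrier[OF hC] S X, symmetric] fCS
      by (rule assoc_mult_mat_vec[OF S mat_diag_dim X])
    then have "(mat_real_fun f C *\<^sub>v v) \<bullet>c v = Y \<bullet>c X"
      using cscalar_adjoint[OF S Y v] assoc_mult_mat_vec[OF T S X] X by (simp add: v_def TS flip: T_def)
    also have "\<dots> = (\<Sum>l<M. complex_of_real (f (e l) * (cmod (x l))\<^sup>2))"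
      unfolding cscalar_prod_sum[OF Y X]
      by (intro sum.cong refl) (simp add: Yi X_def complex_norm_square[unfolded of_real_power] mult_ac)
    finally show ?thesis by simp
  qed
  have "0 \<le> Re (((mat_combination (1/2) (mat_real_fun f A) (mat_real_fun f B) - mat_real_fun f C) *\<^sub>v v) \<bullet>c v)"
    using psd v by (simp add: pos_semidef_mat_def)
  also have "\<dots> = (\<Sum>k<N. f (d k) * (cmod (v $ k))\<^sup>2) - (\<Sum>l<M. f (e l) * (cmod (x l))\<^sup>2)"
    unfolding quadratic_form_combination[OF mat_fun_hermitian_carrier[OF hA] mat_fun_hermitian_carrier[OF hB]
        mat_fun_hermitian_carrier[OF hC] v] qA qB qC by (simp add: field_simps)
  finally show ?thesis by (simp add: vi)
qed

text \<open>Enumerations of \<open>K\<close> and \<open>L\<close> carry the matrix version, indexed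
  by initial segments of the naturals, to the pairs and triples that label the eigenbases of a
  mixture.\<close>

lemma operator_jensen:
  fixes V :: "'k \<Rightarrow> 'l \<Rightarrow> complex" and d :: "'k \<Rightarrow> real" and e :: "'l \<Rightarrow> real" and x :: "'l \<Rightarrow> complex"
  assumes fin: "finite K" "finite L"
    and convex: "operator_convex_on I f" and d: "\<And>k. k \<in> K \<Longrightarrow> d k \<in> I"
    and isom: "\<And>l m. l \<in> L \<Longrightarrow> m \<in> L \<Longrightarrow> (\<Sum>k\<in>K. cnj (V k l) * V k m) = (if l = m then 1 else 0)"
    and compress: "\<And>l m. l \<in> L \<Longrightarrow> m \<in> L \<Longrightarrow>
      (\<Sum>k\<in>K. cnj (V k l) * d k * V k m) = (if l = m then complex_of_real (e l) else 0)"
  shows "(\<Sum>l\<in>L. f (e l) * (cmod (x l))\<^sup>2) \<le> (\<Sum>k\<in>K. f (d k) * (cmod (\<Sum>l\<in>L. V k l * x l))\<^sup>2)"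
proof -
  obtain \<phi> \<psi> where \<phi>: "bij_betw \<phi> {..<card K} K" and \<psi>: "bij_betw \<psi> {..<card L} L"
    using ex_bij_betw_nat_finite[OF fin(1)] ex_bij_betw_nat_finite[OF fin(2)] by (auto simp: lessThan_atLeast0)
  note r = sum.reindex_bij_betw[OF \<phi>, symmetric] sum.reindex_bij_betw[OF \<psi>, symmetric]
  have mem: "k < card K \<Longrightarrow> \<phi> k \<in> K" "l < card L \<Longrightarrow> \<psi> l \<in> L" for k l
    using \<phi> \<psi> by (auto simp: bij_betw_def)
  have inj: "l < card L \<Longrightarrow> m < card L \<Longrightarrow> \<psi> l = \<psi> m \<longleftrightarrow> l = m" for l m
    using \<psi> by (auto simp: bij_betw_def inj_on_def)
  show ?thesis
    unfolding r
    by (rule operator_jensen_nat[OF convex])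
      (auto simp: d mem isom[unfolded r] compress[unfolded r] inj)
qed

section \<open>Diffused functions\<close>

text \<open>The integrand of \<open>diffused\<close> without the density. The parameter
  \<open>y\<close> precedes \<open>t\<close> so that fixing it yields a function of
  \<open>t\<close>, to be compared with \<open>f\<close>.\<close>

definition diffused_kernel :: "real \<Rightarrow> real \<Rightarrow> real \<Rightarrow> real \<Rightarrow> real" where
  "diffused_kernel t\<^sub>0 a y t = (t - t\<^sub>0)\<^sup>2 / (a\<^sup>2 - (t - t\<^sub>0) * y)"

lemma diffused_kernel_denominator_pos:
  fixes t t\<^sub>0 a y :: real
  assumes "t \<in> {t\<^sub>0 - a<..<t\<^sub>0 + a}" "y \<in> {-a..a}"
  shows "0 < a\<^sup>2 - (t - t\<^sub>0) * y"
proof -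
  have "(t - t\<^sub>0) * y \<le> \<bar>t - t\<^sub>0\<bar> * \<bar>y\<bar>" by (metis abs_ge_self abs_mult)
  also have "\<dots> \<le> \<bar>t - t\<^sub>0\<bar> * a" using assms by (intro mult_left_mono) auto
  also have "\<dots> < a * a" using assms by (intro mult_strict_right_mono) auto
  finally show ?thesis by (simp add: power2_eq_square)
qed

text \<open>Affine functions are the equality case of Jensen's inequality: the constant 1 gives V* V
  = 1, the identity gives V* d V = e, and the rest is linearity. A second vector \<open>w\<close> is
  present because the variational formula for the kernels pairs two different vectors.\<close>

lemma compression_affine:
  fixes V :: "'k \<Rightarrow> 'l \<Rightarrow> complex" and d :: "'k \<Rightarrow> real" and e :: "'l \<Rightarrow> real" and x w :: "'l \<Rightarrow> complex"
  assumes fin: "finite L"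
    and isom: "\<And>l m. l \<in> L \<Longrightarrow> m \<in> L \<Longrightarrow> (\<Sum>k\<in>K. cnj (V k l) * V k m) = (if l = m then 1 else 0)"
    and compress: "\<And>l m. l \<in> L \<Longrightarrow> m \<in> L \<Longrightarrow>
      (\<Sum>k\<in>K. cnj (V k l) * d k * V k m) = (if l = m then complex_of_real (e l) else 0)"
  shows "(\<Sum>k\<in>K. complex_of_real (\<alpha> + \<beta> * d k) * (\<Sum>l\<in>L. V k l * x l) * cnj (\<Sum>l\<in>L. V k l * w l))
    = (\<Sum>l\<in>L. complex_of_real (\<alpha> + \<beta> * e l) * x l * cnj (w l))"
proof -
  have "(\<Sum>k\<in>K. complex_of_real (\<alpha> + \<beta> * d k) * (\<Sum>l\<in>L. V k l * x l) * cnj (\<Sum>l\<in>L. V k l * w l))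
    = (\<Sum>k\<in>K. \<Sum>l\<in>L. \<Sum>m\<in>L. complex_of_real (\<alpha> + \<beta> * d k) * (V k l * x l) * cnj (V k m * w m))"
    unfolding mult.assoc cnj_sum sum_product unfolding sum_distrib_left ..
  also have "\<dots> = (\<Sum>l\<in>L. \<Sum>k\<in>K. \<Sum>m\<in>L. complex_of_real (\<alpha> + \<beta> * d k) * (V k l * x l) * cnj (V k m * w m))"
    by (rule sum.swap)
  also have "\<dots> = (\<Sum>l\<in>L. \<Sum>m\<in>L. \<Sum>k\<in>K. complex_of_real (\<alpha> + \<beta> * d k) * (V k l * x l) * cnj (V k m * w m))"
    by (rule sum.cong[OF refl], rule sum.swap)
  also have "\<dots> = (\<Sum>l\<in>L. \<Sum>m\<in>L. x l * cnj (w m) *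
     (\<alpha> * (\<Sum>k\<in>K. cnj (V k m) * V k l) + \<beta> * (\<Sum>k\<in>K. cnj (V k m) * d k * V k l)))"
    unfolding sum_distrib_left sum.distrib[symmetric]
    by (intro sum.cong refl) (simp add: algebra_simps)
  also have "\<dots> = (\<Sum>l\<in>L. \<Sum>m\<in>L. if m = l then complex_of_real (\<alpha> + \<beta> * e l) * x l * cnj (w l) else 0)"
  proof (intro sum.cong refl)
    fix l m assume "l \<in> L" "m \<in> L"
    show "x l * cnj (w m) * (\<alpha> * (\<Sum>k\<in>K. cnj (V k m) * V k l) + \<beta> * (\<Sum>k\<in>K. cnj (V k m) * d k * V k l))
      = (if m = l then complex_of_real (\<alpha> + \<beta> * e l) * x l * cnj (w l) else 0)"
      unfolding isom[OF \<open>m \<in> L\<close> \<open>l \<in> L\<close>] compress[OF \<open>m \<in> L\<close> \<open>l \<in> L\<close>] by simp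
  qed
  also have "\<dots> = (\<Sum>l\<in>L. complex_of_real (\<alpha> + \<beta> * e l) * x l * cnj (w l))"
    using fin by simp
  finally show ?thesis .
qed

text \<open>Both sides are suprema over \<open>w\<close> of \<open>2 Re (s x w\<^sup>*) - m |w|\<^sup>2\<close> with \<open>s = t - t\<^sub>0\<close> and
  \<open>m = a\<^sup>2 - s y\<close> affine in \<open>t\<close>, and such expressions are preserved by the compression.\<close>

lemma diffused_kernel_jensen:
  fixes V :: "'k \<Rightarrow> 'l \<Rightarrow> complex" and d :: "'k \<Rightarrow> real" and e :: "'l \<Rightarrow> real" and x :: "'l \<Rightarrow> complex"
  assumes fin: "finite L"
    and d: "\<And>k. k \<in> K \<Longrightarrow> d k \<in> {t\<^sub>0 - a<..<t\<^sub>0 + a}" and e: "\<And>l. l \<in> L \<Longrightarrow> e l \<in> {t\<^sub>0 - a<..<t\<^sub>0 + a}"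
    and y: "y \<in> {-a..a}"
    and isom: "\<And>l m. l \<in> L \<Longrightarrow> m \<in> L \<Longrightarrow> (\<Sum>k\<in>K. cnj (V k l) * V k m) = (if l = m then 1 else 0)"
    and compress: "\<And>l m. l \<in> L \<Longrightarrow> m \<in> L \<Longrightarrow>
      (\<Sum>k\<in>K. cnj (V k l) * d k * V k m) = (if l = m then complex_of_real (e l) else 0)"
  shows "(\<Sum>l\<in>L. diffused_kernel t\<^sub>0 a y (e l) * (cmod (x l))\<^sup>2)
    \<le> (\<Sum>k\<in>K. diffused_kernel t\<^sub>0 a y (d k) * (cmod (\<Sum>l\<in>L. V k l * x l))\<^sup>2)"
proof -
  note affine = compression_affine[where V = V and K = K and d = d and e = e, OF fin isom compress]
  define s where "s t = t - t\<^sub>0" for t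
  define m where "m t = a\<^sup>2 - s t * y" for t
  have mpos: "t \<in> {t\<^sub>0 - a<..<t\<^sub>0 + a} \<Longrightarrow> m t > 0" for t
    using diffused_kernel_denominator_pos[OF _ y] by (simp add: m_def s_def)
  \<comment> \<open>The point where the supremum on the \<open>L\<close> side is attained. Its image
    \<open>Y\<close> need not be optimal on the \<open>K\<close> side, which is the source of the
    inequality.\<close>
  define w where "w l = complex_of_real (s (e l) / m (e l)) * x l" for l
  define X where "X k = (\<Sum>l\<in>L. V k l * x l)" for k
  define Y where "Y k = (\<Sum>l\<in>L. V k l * w l)" for k
  have sa: "(\<Sum>k\<in>K. complex_of_real (s (d k)) * X k * cnj (Y k)) = (\<Sum>l\<in>L. complex_of_real (s (e l)) * x l * cnj (w l))"
    using affine[where \<alpha> = "- t\<^sub>0" and \<beta> = 1 and x = x and w = w] by (simp add: X_def Y_def s_def)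
  have ma: "(\<Sum>k\<in>K. complex_of_real (m (d k)) * Y k * cnj (Y k)) = (\<Sum>l\<in>L. complex_of_real (m (e l)) * w l * cnj (w l))"
    using affine[where \<alpha> = "a\<^sup>2 + t\<^sub>0 * y" and \<beta> = "- y" and x = w and w = w] by (simp add: Y_def m_def s_def algebra_simps)
  have "(\<Sum>l\<in>L. diffused_kernel t\<^sub>0 a y (e l) * (cmod (x l))\<^sup>2)
    = Re (\<Sum>l\<in>L. 2 * (complex_of_real (s (e l)) * x l * cnj (w l)) - complex_of_real (m (e l)) * w l * cnj (w l))"
    unfolding Re_sum
  proof (intro sum.cong refl)
    fix l assume "l \<in> L"
    then have m: "m (e l) \<noteq> 0" using mpos[OF e] by force
    let ?c = "complex_of_real ((s (e l))\<^sup>2 / m (e l))"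
    have "2 * (complex_of_real (s (e l)) * x l * cnj (w l)) - complex_of_real (m (e l)) * w l * cnj (w l)
      = ?c * (x l * cnj (x l))"
    proof -
      have "2 * (\<alpha> * \<xi> * (\<alpha> / \<mu> * \<eta>)) - \<mu> * (\<alpha> / \<mu> * \<xi>) * (\<alpha> / \<mu> * \<eta>) = \<alpha>\<^sup>2 / \<mu> * (\<xi> * \<eta>)"
        if "\<mu> \<noteq> 0" for \<alpha> \<mu> \<xi> \<eta> :: complex
        using that by (simp add: field_simps power2_eq_square)
      from this[of "complex_of_real (m (e l))" "complex_of_real (s (e l))" "x l" "cnj (x l)"] m
      show ?thesis by (simp add: w_def)
    qed
    also have "\<dots> = complex_of_real ((s (e l))\<^sup>2 / m (e l) * (cmod (x l))\<^sup>2)"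
      by (simp only: complex_norm_square of_real_mult)
    finally show "diffused_kernel t\<^sub>0 a y (e l) * (cmod (x l))\<^sup>2 =
      Re (2 * (complex_of_real (s (e l)) * x l * cnj (w l)) - complex_of_real (m (e l)) * w l * cnj (w l))"
      by (simp only: Re_complex_of_real) (simp add: diffused_kernel_def m_def s_def)
  qed
  also have "\<dots> = Re (\<Sum>k\<in>K. 2 * (complex_of_real (s (d k)) * X k * cnj (Y k)) - complex_of_real (m (d k)) * Y k * cnj (Y k))"
    unfolding sum_subtractf sum_distrib_left[symmetric] sa ma ..
  also have "\<dots> \<le> (\<Sum>k\<in>K. diffused_kernel t\<^sub>0 a y (d k) * (cmod (X k))\<^sup>2)"
    unfolding Re_sum
  proof (rule sum_mono)
    fix k assume "k \<in> K"
    then have m: "m (d k) > 0" using mpos[OF d] by force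
    \<comment> \<open>Completing the square: the gap to the supremum is |s X - m Y|^2 / m.\<close>
    have "(s (d k))\<^sup>2 / m (d k) * (cmod (X k))\<^sup>2
        - Re (2 * (complex_of_real (s (d k)) * X k * cnj (Y k)) - complex_of_real (m (d k)) * Y k * cnj (Y k))
      = (cmod (complex_of_real (s (d k)) * X k - complex_of_real (m (d k)) * Y k))\<^sup>2 / m (d k)"
    proof -
      have "\<alpha>\<^sup>2 / \<mu> * (\<xi>\<^sup>2 + \<xi>'\<^sup>2) - (2 * (\<alpha> * \<xi> * \<eta> + \<alpha> * \<xi>' * \<eta>') - (\<mu> * \<eta> * \<eta> + \<mu> * \<eta>' * \<eta>'))
        = ((\<alpha> * \<xi> - \<mu> * \<eta>)\<^sup>2 + (\<alpha> * \<xi>' - \<mu> * \<eta>')\<^sup>2) / \<mu>" if "\<mu> \<noteq> 0" for \<alpha> \<mu> \<xi> \<xi>' \<eta> \<eta>' :: real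
        using that by (simp add: field_simps power2_eq_square)
      from this[of "m (d k)" "s (d k)" "Re (X k)" "Im (X k)" "Re (Y k)" "Im (Y k)"] m
      show ?thesis by (simp add: cmod_power2)
    qed
    also have "\<dots> \<ge> 0" using m by simp
    finally show "Re (2 * (complex_of_real (s (d k)) * X k * cnj (Y k)) - complex_of_real (m (d k)) * Y k * cnj (Y k))
      \<le> diffused_kernel t\<^sub>0 a y (d k) * (cmod (X k))\<^sup>2"
      by (simp add: diffused_kernel_def m_def s_def)
  qed
  finally show ?thesis by (simp add: X_def)
qed

section \<open>Signed measures with finitely many atoms\<close>

lemma sum_eq_0_if_atoms_0:
  fixes g :: "real \<Rightarrow> 'v::real_vector"
  assumes "finite J" "\<And>v. (\<Sum>j\<in>{j \<in> J. r j = v}. c j) = 0"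
  shows "(\<Sum>j\<in>J. c j *\<^sub>R g (r j)) = 0"
proof -
  \<comment> \<open>Different indices may carry the same value of \<open>r\<close>, so an atom is
    the sum of \<open>c\<close> over a fibre of \<open>r\<close>.\<close>
  have "(\<Sum>j\<in>J. c j *\<^sub>R g (r j)) = (\<Sum>v\<in>r ` J. \<Sum>j\<in>{j \<in> J. r j = v}. c j *\<^sub>R g (r j))"
    using assms(1) by (intro sum.group[symmetric]) auto
  also have "\<dots> = (\<Sum>v\<in>r ` J. (\<Sum>j\<in>{j \<in> J. r j = v}. c j) *\<^sub>R g v)"
    by (intro sum.cong refl) (auto simp: scaleR_sum_left intro!: sum.cong)
  finally show ?thesis using assms(2) by simp
qed

text \<open>By linearity every polynomial is annihilated, in particular the one that vanishes at all
  other values of \<open>r\<close> but not at \<open>v\<close>. It isolates the atom at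
  \<open>v\<close>.\<close>

lemma atoms_0_if_moments_0:
  fixes c r :: "'j \<Rightarrow> real"
  assumes fin: "finite J" and moments: "\<And>m :: nat. (\<Sum>j\<in>J. c j * r j ^ m) = 0"
  shows "(\<Sum>j\<in>{j \<in> J. r j = v}. c j) = 0"
proof (cases "v \<in> r ` J")
  case True
  define P where "P = (\<Prod>u\<in>r ` J - {v}. [:- u, 1:])"
  have P: "poly P u = (\<Prod>u'\<in>r ` J - {v}. u - u')" for u by (simp add: P_def poly_prod)
  have "(\<Sum>j\<in>J. c j * poly P (r j)) = (\<Sum>j\<in>J. \<Sum>m\<le>degree P. Polynomial.coeff P m * (c j * r j ^ m))"
    by (simp add: poly_altdef sum_distrib_left mult_ac)
  also have "\<dots> = (\<Sum>m\<le>degree P. Polynomial.coeff P m * (\<Sum>j\<in>J. c j * r j ^ m))"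
    unfolding sum_distrib_left by (rule sum.swap)
  finally have "(\<Sum>j\<in>J. c j * poly P (r j)) = 0" by (simp add: moments)
  also have "(\<Sum>j\<in>J. c j * poly P (r j)) = (\<Sum>j\<in>{j \<in> J. r j = v}. c j * poly P (r j))"
    using fin by (intro sum.mono_neutral_right) (auto simp: P prod_zero_iff)
  also have "\<dots> = (\<Sum>j\<in>{j \<in> J. r j = v}. c j) * poly P v"
    by (simp add: sum_distrib_right)
  finally show ?thesis using fin by (auto simp: P)
next
  case False
  then have "{j \<in> J. r j = v} = {}" by auto
  then show ?thesis by (simp only: sum.empty)
qed

text \<open>The left-hand side is a rational function of \<open>y\<close> whose pole at \<open>A / v\<close> has residue
  proportional to the atom at \<open>v\<close>.\<close>

lemma atoms_0_if_rational_0: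
  fixes c s :: "'j \<Rightarrow> real"
  assumes fin: "finite J" and inf: "infinite Y" and A: "A \<noteq> 0"
    and nz: "\<And>j y. j \<in> J \<Longrightarrow> y \<in> Y \<Longrightarrow> A - s j * y \<noteq> 0"
    and eq: "\<And>y. y \<in> Y \<Longrightarrow> (\<Sum>j\<in>J. c j * ((s j)\<^sup>2 / (A - s j * y))) = 0"
    and v: "v \<noteq> 0"
  shows "(\<Sum>j\<in>{j \<in> J. s j = v}. c j) = 0"
proof (cases "v \<in> s ` J")
  case True
  define C where "C u = (\<Sum>j\<in>{j \<in> J. s j = u}. c j)" for u
  \<comment> \<open>The numerator left after multiplying by all denominators, with the indices
    merged into atoms \<open>C u\<close>.\<close>
  define Q where "Q = (\<Sum>u\<in>s ` J. Polynomial.smult (C u * u\<^sup>2) (\<Prod>u'\<in>s ` J - {u}. [:A, - u':]))"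
  have Q: "poly Q y = (\<Sum>u\<in>s ` J. C u * u\<^sup>2 * (\<Prod>u'\<in>s ` J - {u}. A - u' * y))" for y
    by (simp add: Q_def poly_sum poly_prod mult_ac)
  have "poly Q y = 0" if y: "y \<in> Y" for y
  proof -
    have "0 = (\<Sum>v\<in>s ` J. \<Sum>j\<in>{j \<in> J. s j = v}. c j * ((s j)\<^sup>2 / (A - s j * y)))"
      using fin eq[OF y] by (subst sum.group) auto
    also have "\<dots> = (\<Sum>u\<in>s ` J. C u * (u\<^sup>2 / (A - u * y)))"
      unfolding C_def sum_distrib_right by (intro sum.cong refl) auto
    finally have "0 = (\<Sum>u\<in>s ` J. C u * (u\<^sup>2 / (A - u * y))) * (\<Prod>u\<in>s ` J. A - u * y)" by simp
    also have "\<dots> = poly Q y"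
      unfolding Q sum_distrib_right
    proof (intro sum.cong refl)
      fix u assume u: "u \<in> s ` J"
      then have "A - u * y \<noteq> 0" using nz y by auto
      then show "C u * (u\<^sup>2 / (A - u * y)) * (\<Prod>u\<in>s ` J. A - u * y) = C u * u\<^sup>2 * (\<Prod>u'\<in>s ` J - {u}. A - u' * y)"
        using prod.remove[OF finite_imageI[OF fin] u, of "\<lambda>u. A - u * y"] by simp
    qed
    finally show ?thesis by simp
  qed
  then have "Y \<subseteq> {y. poly Q y = 0}" by auto
  then have "Q = 0" using inf poly_roots_finite finite_subset by blast
  \<comment> \<open>At the pole \<open>A / v\<close> only the term of \<open>v\<close> survives,
    because every other product contains the factor A - v (A / v) = 0.\<close>
  then have "0 = (\<Sum>u\<in>s ` J. C u * u\<^sup>2 * (\<Prod>u'\<in>s ` J - {u}. A - u' * (A / v)))"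
    using Q[of "A / v"] by simp
  also have "\<dots> = C v * v\<^sup>2 * (\<Prod>u'\<in>s ` J - {v}. A - u' * (A / v))"
  proof (subst sum.remove[OF finite_imageI[OF fin] True], subst sum.neutral)
    show "\<forall>u\<in>s ` J - {v}. C u * u\<^sup>2 * (\<Prod>u'\<in>s ` J - {u}. A - u' * (A / v)) = 0"
    proof
      fix u assume "u \<in> s ` J - {v}"
      then have "(\<Prod>u'\<in>s ` J - {u}. A - u' * (A / v)) = 0"
        using fin True v by (intro prod_zero bexI[of _ v]) auto
      then show "C u * u\<^sup>2 * (\<Prod>u'\<in>s ` J - {u}. A - u' * (A / v)) = 0" by simp
    qed
  qed simp
  finally have "C v = 0 \<or> (\<Prod>u'\<in>s ` J - {v}. A - u' * (A / v)) = 0" using v by simp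
  moreover have "A - u' * (A / v) \<noteq> 0" if "u' \<noteq> v" for u'
    using that v A by (simp add: field_simps)
  ultimately have "C v = 0" using fin by auto
  then show ?thesis by (simp add: C_def)
next
  case False
  then have "{j \<in> J. s j = v} = {}" by auto
  then show ?thesis by (simp only: sum.empty)
qed

text \<open>For t in the open interval the denominator has no zero on the closed interval of
  parameters, so the kernel is continuous in \<open>y\<close> and bounded by compactness.\<close>

lemma diffused_kernel_integrable:
  assumes t: "t \<in> {t\<^sub>0 - a<..<t\<^sub>0 + a}" and p: "set_integrable lborel {-a..a} p"
  shows "set_integrable lborel {-a..a} (\<lambda>y. diffused_kernel t\<^sub>0 a y t * p y)"
proof -
  let ?S = "{-a..a}"
  have cont: "continuous_on ?S (\<lambda>y. diffused_kernel t\<^sub>0 a y t)"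
    unfolding diffused_kernel_def
    by (intro continuous_intros ballI) (use diffused_kernel_denominator_pos[OF t] in force)
  then have "bounded ((\<lambda>y. diffused_kernel t\<^sub>0 a y t) ` ?S)"
    by (intro compact_imp_bounded compact_continuous_image) auto
  then obtain B where B: "\<And>y. y \<in> ?S \<Longrightarrow> \<bar>diffused_kernel t\<^sub>0 a y t\<bar> \<le> B"
    unfolding bounded_iff real_norm_def by blast
  have k: "(\<lambda>y. indicator ?S y *\<^sub>R diffused_kernel t\<^sub>0 a y t) \<in> borel_measurable borel"
    by (rule borel_measurable_continuous_on_indicator[OF _ cont]) simp
  have p': "(\<lambda>y. indicator ?S y *\<^sub>R p y) \<in> borel_measurable lborel"
    using p by (auto simp: set_integrable_def)
  have "integrable lborel (\<lambda>y. B * (indicator ?S y *\<^sub>R p y))"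
    using p by (simp add: set_integrable_def)
  then show ?thesis
    unfolding set_integrable_def
  proof (rule Bochner_Integration.integrable_bound)
    \<comment> \<open>\<open>set_integrable\<close> makes \<open>p\<close> measurable only after
      multiplication by the indicator, hence the two truncated factors.\<close>
    have "(\<lambda>y. (indicator ?S y *\<^sub>R diffused_kernel t\<^sub>0 a y t) * (indicator ?S y *\<^sub>R p y)) \<in> borel_measurable lborel"
      using k p' by (intro borel_measurable_times) auto
    moreover have "(\<lambda>y. (indicator ?S y *\<^sub>R diffused_kernel t\<^sub>0 a y t) * (indicator ?S y *\<^sub>R p y))
      = (\<lambda>y. indicator ?S y *\<^sub>R (diffused_kernel t\<^sub>0 a y t * p y))"
      by (auto simp: fun_eq_iff indicator_def)
    ultimately show "(\<lambda>y. indicator ?S y *\<^sub>R (diffused_kernel t\<^sub>0 a y t * p y)) \<in> borel_measurable lborel" by simp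
    show "AE y in lborel. norm (indicator ?S y *\<^sub>R (diffused_kernel t\<^sub>0 a y t * p y)) \<le> norm (B * (indicator ?S y *\<^sub>R p y))"
    proof (intro AE_I2)
      fix y
      have "\<bar>diffused_kernel t\<^sub>0 a y t\<bar> * \<bar>p y\<bar> \<le> \<bar>B\<bar> * \<bar>p y\<bar>" if "y \<in> ?S"
        using B[OF that] by (intro mult_right_mono) auto
      then show "norm (indicator ?S y *\<^sub>R (diffused_kernel t\<^sub>0 a y t * p y)) \<le> norm (B * (indicator ?S y *\<^sub>R p y))"
        by (auto simp: indicator_def abs_mult)
    qed
  qed
qed

text \<open>The affine part of \<open>f\<close> contributes nothing, so \<kappa> times the integral
  of the nonnegative function \<open>D y * p y\<close> is 0. Hence \<open>D\<close> vanishes almost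
  everywhere on the subinterval where the density is positive, in particular at infinitely many
  parameters.\<close>

lemma atoms_0_if_diffused_0:
  fixes c r :: "'j \<Rightarrow> real"
  assumes fin: "finite J" and diff: "diffused t\<^sub>0 a f"
    and r: "\<And>j. j \<in> J \<Longrightarrow> r j \<in> {t\<^sub>0 - a<..<t\<^sub>0 + a}"
    and one: "(\<Sum>j\<in>J. c j) = 0" and id: "(\<Sum>j\<in>J. c j * r j) = 0"
    and kernel: "\<And>y. y \<in> {-a..a} \<Longrightarrow> 0 \<le> (\<Sum>j\<in>J. c j * diffused_kernel t\<^sub>0 a y (r j))"
    and f: "(\<Sum>j\<in>J. c j * f (r j)) = 0"
  shows "(\<Sum>j\<in>{j \<in> J. r j = v}. c j) = 0"
proof -
  let ?S = "{-a..a}"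
  obtain b b' \<kappa> p u w where \<kappa>: "0 < \<kappa>" and p: "prob_density_on ?S p"
    and uw: "- a \<le> u" "u < w" "w \<le> a" and ppos: "AE x in lborel. x \<in> {u<..<w} \<longrightarrow> 0 < p x"
    and fr: "\<And>t. t \<in> {t\<^sub>0 - a<..<t\<^sub>0 + a} \<Longrightarrow> f t = b + b' * t + \<kappa> * (LINT x:?S|lborel. diffused_kernel t\<^sub>0 a x t * p x)"
    and a: "0 < a"
    using diff unfolding diffused_def diffused_kernel_def by blast
  have p0: "\<And>x. x \<in> ?S \<Longrightarrow> 0 \<le> p x" and pint: "set_integrable lborel ?S p"
    using p by (auto simp: prob_density_on_def)
  define D where "D y = (\<Sum>j\<in>J. c j * diffused_kernel t\<^sub>0 a y (r j))" for y
  let ?h = "\<lambda>y. indicator ?S y *\<^sub>R (D y * p y)"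
  have int: "integrable lborel (\<lambda>y. c j * (indicator ?S y *\<^sub>R (diffused_kernel t\<^sub>0 a y (r j) * p y)))" if "j \<in> J" for j
    using diffused_kernel_integrable[OF r[OF that] pint] by (simp add: set_integrable_def)
  have h: "?h = (\<lambda>y. \<Sum>j\<in>J. c j * (indicator ?S y *\<^sub>R (diffused_kernel t\<^sub>0 a y (r j) * p y)))"
    by (simp add: D_def sum_distrib_left sum_distrib_right mult_ac fun_eq_iff)
  have hint: "integrable lborel ?h" unfolding h by (rule Bochner_Integration.integrable_sum[OF int])
  have "0 = (\<Sum>j\<in>J. c j * f (r j))" using f by simp
  also have "\<dots> = (\<Sum>j\<in>J. b * c j + b' * (c j * r j) + \<kappa> * (c j * (LINT x:?S|lborel. diffused_kernel t\<^sub>0 a x (r j) * p x)))"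
    by (intro sum.cong refl) (simp add: fr[OF r] algebra_simps)
  also have "\<dots> = b * (\<Sum>j\<in>J. c j) + b' * (\<Sum>j\<in>J. c j * r j)
      + \<kappa> * (\<Sum>j\<in>J. c j * (LINT x:?S|lborel. diffused_kernel t\<^sub>0 a x (r j) * p x))"
    by (simp only: sum.distrib sum_distrib_left)
  also have "(\<Sum>j\<in>J. c j * (LINT x:?S|lborel. diffused_kernel t\<^sub>0 a x (r j) * p x)) = (LINT x|lborel. ?h x)"
    unfolding h by (subst Bochner_Integration.integral_sum[OF int]) (auto simp: set_lebesgue_integral_def)
  finally have "(LINT x|lborel. ?h x) = 0" using one id \<kappa> by simp
  moreover have "AE x in lborel. 0 \<le> ?h x"
    using kernel p0 by (auto simp: D_def indicator_def)
  ultimately have "AE x in lborel. ?h x = 0"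
    using integral_nonneg_eq_0_iff_AE[OF hint] by blast
  with ppos have ae: "AE x in lborel. x \<in> {u<..<w} \<longrightarrow> D x = 0"
    by eventually_elim (use uw in \<open>auto simp: indicator_def\<close>)
  define Y where "Y = {x \<in> {u<..<w}. D x = 0}"
  \<comment> \<open>Otherwise almost every point would lie outside an interval of positive
    length.\<close>
  have "infinite Y"
  proof
    assume "finite Y"
    then have "AE x in lborel. x \<notin> Y" by (intro AE_not_in finite_imp_null_set_lborel)
    with ae have "AE x in lborel. x \<notin> {u<..<w}" by eventually_elim (auto simp: Y_def)
    then have "emeasure lborel {u<..<w} = 0"
      using AE_iff_null_sets[of "{u<..<w}" lborel] by auto
    then show False using uw by simp
  qed
  have YS: "Y \<subseteq> ?S" using uw by (auto simp: Y_def)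
  have nonzero: "(\<Sum>j\<in>{j \<in> J. r j - t\<^sub>0 = v'}. c j) = 0" if "v' \<noteq> 0" for v'
  proof (rule atoms_0_if_rational_0[OF fin \<open>infinite Y\<close>, where A = "a\<^sup>2"])
    show "a\<^sup>2 - (r j - t\<^sub>0) * y \<noteq> 0" if "j \<in> J" "y \<in> Y" for j y
      using diffused_kernel_denominator_pos[OF r[OF that(1)], of y] YS that(2) by force
    show "(\<Sum>j\<in>J. c j * ((r j - t\<^sub>0)\<^sup>2 / (a\<^sup>2 - (r j - t\<^sub>0) * y))) = 0" if "y \<in> Y" for y
      using that by (simp add: Y_def D_def diffused_kernel_def)
  qed (use a that in auto)
  show ?thesis
  proof (cases "v = t\<^sub>0")
    case False
    then show ?thesis using nonzero[of "v - t\<^sub>0"] by simp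
  next
    case True
    have z: "(\<Sum>j\<in>{j \<in> J. r j = v'}. c j) = 0" if "v' \<noteq> t\<^sub>0" for v'
      using nonzero[of "v' - t\<^sub>0"] that by simp
    \<comment> \<open>The kernels do not see the atom at \<open>t\<^sub>0\<close>, so it is computed
      from the total mass. Inserting \<open>t\<^sub>0\<close> covers the case that no
      \<open>r j\<close> equals it.\<close>
    have "0 = (\<Sum>v'\<in>insert t\<^sub>0 (r ` J). \<Sum>j\<in>{j \<in> J. r j = v'}. c j)"
      using fin one by (subst sum.group) auto
    also have "\<dots> = (\<Sum>j\<in>{j \<in> J. r j = t\<^sub>0}. c j)"
      using fin z by (subst sum.remove[of _ t\<^sub>0]) auto
    finally show ?thesis using True by simp
  qed
qed

lemma exp_ln_of_nat_mult: "0 < r \<Longrightarrow> exp (of_nat m * complex_of_real (ln r)) = complex_of_real (r ^ m)"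
  by (simp add: exp_of_nat_mult exp_of_real)

text \<open>Both conditions say that one signed measure has no atoms: the measure with mass |(V
  x)_k|^2 at \<open>d k\<close> and mass - |x_l|^2 at \<open>e l\<close>.\<close>

theorem diffused_jensen_equality_iff:
  fixes V :: "'k \<Rightarrow> 'l \<Rightarrow> complex" and d :: "'k \<Rightarrow> real" and e :: "'l \<Rightarrow> real" and x :: "'l \<Rightarrow> complex"
  assumes fin: "finite K" "finite L" and diff: "diffused t\<^sub>0 a f"
    and pos: "{t\<^sub>0 - a<..<t\<^sub>0 + a} \<subseteq> {0<..}"
    and d: "\<And>k. k \<in> K \<Longrightarrow> d k \<in> {t\<^sub>0 - a<..<t\<^sub>0 + a}" and e: "\<And>l. l \<in> L \<Longrightarrow> e l \<in> {t\<^sub>0 - a<..<t\<^sub>0 + a}"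
    and isom: "\<And>l m. l \<in> L \<Longrightarrow> m \<in> L \<Longrightarrow> (\<Sum>k\<in>K. cnj (V k l) * V k m) = (if l = m then 1 else 0)"
    and compress: "\<And>l m. l \<in> L \<Longrightarrow> m \<in> L \<Longrightarrow>
      (\<Sum>k\<in>K. cnj (V k l) * d k * V k m) = (if l = m then complex_of_real (e l) else 0)"
  shows "(\<Sum>l\<in>L. f (e l) * (cmod (x l))\<^sup>2) = (\<Sum>k\<in>K. f (d k) * (cmod (\<Sum>l\<in>L. V k l * x l))\<^sup>2)
    \<longleftrightarrow> (\<forall>z::complex. (\<Sum>l\<in>L. exp (z * ln (e l)) * complex_of_real ((cmod (x l))\<^sup>2))
           = (\<Sum>k\<in>K. exp (z * ln (d k)) * complex_of_real ((cmod (\<Sum>l\<in>L. V k l * x l))\<^sup>2)))"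
    (is "?eq \<longleftrightarrow> (\<forall>z. ?exp z)")
proof -
  \<comment> \<open>The disjoint sum puts both families of points, with their signs, into a single
    measure.\<close>
  define J where "J = K <+> L"
  define c where "c = case_sum (\<lambda>k. (cmod (\<Sum>l\<in>L. V k l * x l))\<^sup>2) (\<lambda>l. - (cmod (x l))\<^sup>2)"
  define r where "r = case_sum d e"
  have finJ: "finite J" using fin by (simp add: J_def)
  have rJ: "r j \<in> {t\<^sub>0 - a<..<t\<^sub>0 + a}" if "j \<in> J" for j
    using that d e by (auto simp: J_def r_def split: sum.split)
  \<comment> \<open>Vector values let one formula serve the real \<open>f\<close> and the complex
    exponentials.\<close>
  have J: "(\<Sum>j\<in>J. c j *\<^sub>R g (r j))
    = (\<Sum>k\<in>K. (cmod (\<Sum>l\<in>L. V k l * x l))\<^sup>2 *\<^sub>R g (d k)) - (\<Sum>l\<in>L. (cmod (x l))\<^sup>2 *\<^sub>R g (e l))"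
    for g :: "real \<Rightarrow> 'v::real_vector"
    using fin by (simp add: J_def c_def r_def sum.Plus sum_negf)
  have Jr: "(\<Sum>j\<in>J. c j * g (r j))
    = (\<Sum>k\<in>K. g (d k) * (cmod (\<Sum>l\<in>L. V k l * x l))\<^sup>2) - (\<Sum>l\<in>L. g (e l) * (cmod (x l))\<^sup>2)" for g :: "real \<Rightarrow> real"
    using J[of g] by (simp add: mult.commute)
  have affine: "(\<Sum>j\<in>J. c j * (\<alpha> + \<beta> * r j)) = 0" for \<alpha> \<beta>
  proof -
    have "complex_of_real (\<Sum>k\<in>K. (\<alpha> + \<beta> * d k) * (cmod (\<Sum>l\<in>L. V k l * x l))\<^sup>2)
      = complex_of_real (\<Sum>l\<in>L. (\<alpha> + \<beta> * e l) * (cmod (x l))\<^sup>2)"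
      using compression_affine[where V = V and K = K and d = d and e = e and \<alpha> = \<alpha> and \<beta> = \<beta> and x = x and w = x, OF fin(2) isom compress]
      by (simp only: of_real_sum of_real_mult complex_norm_square mult.assoc)
    then show ?thesis
      using Jr[of "\<lambda>t. \<alpha> + \<beta> * t"] by (simp only: of_real_eq_iff)
  qed
  have atoms: "(\<forall>v. (\<Sum>j\<in>{j \<in> J. r j = v}. c j) = 0) \<longleftrightarrow> ?eq"
  proof
    assume "\<forall>v. (\<Sum>j\<in>{j \<in> J. r j = v}. c j) = 0"
    then show ?eq using sum_eq_0_if_atoms_0[OF finJ, where r = r and c = c and g = f] Jr[of f] by simp
  next
    assume ?eq
    show "\<forall>v. (\<Sum>j\<in>{j \<in> J. r j = v}. c j) = 0"
    proof
      fix v show "(\<Sum>j\<in>{j \<in> J. r j = v}. c j) = 0"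
      proof (rule atoms_0_if_diffused_0[OF finJ diff rJ])
        show "(\<Sum>j\<in>J. c j) = 0" using affine[of 1 0] by simp
        show "(\<Sum>j\<in>J. c j * r j) = 0" using affine[of 0 1] by simp
        show "(\<Sum>j\<in>J. c j * f (r j)) = 0" using \<open>?eq\<close> Jr[of f] by simp
        show "0 \<le> (\<Sum>j\<in>J. c j * diffused_kernel t\<^sub>0 a y (r j))" if "y \<in> {-a..a}" for y
          using diffused_kernel_jensen[of L K d t\<^sub>0 a e y V x, OF fin(2) d e that isom compress]
            Jr[of "diffused_kernel t\<^sub>0 a y"] by simp
      qed
    qed
  qed
  have exp_eq: "?exp z \<longleftrightarrow> (\<Sum>j\<in>J. c j *\<^sub>R exp (z * ln (r j))) = 0" for z
    unfolding J[of "\<lambda>t. exp (z * complex_of_real (ln t))"] by (auto simp: scaleR_conv_of_real mult.commute)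
  have "(\<forall>v. (\<Sum>j\<in>{j \<in> J. r j = v}. c j) = 0) \<longleftrightarrow> (\<forall>z. ?exp z)"
  proof
    assume "\<forall>v. (\<Sum>j\<in>{j \<in> J. r j = v}. c j) = 0"
    then show "\<forall>z. ?exp z"
      unfolding exp_eq by (intro allI sum_eq_0_if_atoms_0[OF finJ, where g = "\<lambda>t. exp (_ * complex_of_real (ln t))"]) simp
  next
    assume exp: "\<forall>z. ?exp z"
    \<comment> \<open>The exponents z = m yield the power moments; exp (m ln r) = r^m uses that the
      interval is positive.\<close>
    have "(\<Sum>j\<in>J. c j * r j ^ m) = 0" for m :: nat
    proof -
      have "complex_of_real (\<Sum>j\<in>J. c j * r j ^ m) = (\<Sum>j\<in>J. c j *\<^sub>R exp (of_nat m * complex_of_real (ln (r j))))"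
        unfolding of_real_sum using rJ pos
        by (intro sum.cong refl) (force simp: exp_ln_of_nat_mult scaleR_conv_of_real)
      also have "\<dots> = 0" using exp exp_eq[of "of_nat m"] by simp
      finally show ?thesis by (simp only: of_real_eq_0_iff)
    qed
    then show "\<forall>v. (\<Sum>j\<in>{j \<in> J. r j = v}. c j) = 0"
      using atoms_0_if_moments_0[OF finJ] by blast
  qed
  with atoms show ?thesis by blast
qed

section \<open>Spectral form of the relative entropy\<close>

text \<open>Undoes the row-by-row numbering k = a m + b that \<open>kronecker_mat\<close> and
  \<open>vec_of_rows\<close> use.\<close>

lemma sum_div_mod:
  fixes g :: "nat \<Rightarrow> nat \<Rightarrow> 'a::comm_monoid_add"
  shows "(\<Sum>k<n * m. g (k div m) (k mod m)) = (\<Sum>a<n. \<Sum>b<m. g a b)"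
proof -
  have "bij_betw (\<lambda>(a, b). a * m + b) ({..<n} \<times> {..<m}) {..<n * m}"
  proof (rule bij_betw_byWitness[where f' = "\<lambda>k. (k div m, k mod m)"])
    show "(\<lambda>(a, b). a * m + b) ` ({..<n} \<times> {..<m}) \<subseteq> {..<n * m}"
    proof clarsimp
      fix a b assume "a < n" "b < m"
      then have "a * m + b < Suc a * m" by simp
      also have "\<dots> \<le> n * m" using \<open>a < n\<close> by (intro mult_right_mono) auto
      finally show "a * m + b < n * m" .
    qed
    show "(\<lambda>k. (k div m, k mod m)) ` {..<n * m} \<subseteq> {..<n} \<times> {..<m}"
      by (auto simp: less_mult_imp_div_less intro!: mod_less_divisor) (metis gr0I mult_0_right not_less_zero)
  qed auto
  from sum.reindex_bij_betw[OF this, of "\<lambda>k. g (k div m) (k mod m)"]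
  have "(\<Sum>k<n * m. g (k div m) (k mod m)) = (\<Sum>(a, b)\<in>{..<n} \<times> {..<m}. g a b)"
    by (subst (asm) eq_commute) (auto intro!: sum.cong)
  then show ?thesis by (simp add: sum.cartesian_product)
qed

lemma sum_swap_pairs:
  "(\<Sum>x\<in>A. \<Sum>y\<in>B. \<Sum>j\<in>C. \<Sum>i\<in>D. t x y j i) = (\<Sum>j\<in>C. \<Sum>i\<in>D. \<Sum>x\<in>A. \<Sum>y\<in>B. t x y j i)"
proof -
  have "(\<Sum>x\<in>A. \<Sum>y\<in>B. \<Sum>j\<in>C. \<Sum>i\<in>D. t x y j i) = (\<Sum>x\<in>A. \<Sum>j\<in>C. \<Sum>y\<in>B. \<Sum>i\<in>D. t x y j i)"
    by (intro sum.cong refl) (rule sum.swap)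
  also have "\<dots> = (\<Sum>j\<in>C. \<Sum>x\<in>A. \<Sum>y\<in>B. \<Sum>i\<in>D. t x y j i)" by (rule sum.swap)
  also have "\<dots> = (\<Sum>j\<in>C. \<Sum>x\<in>A. \<Sum>i\<in>D. \<Sum>y\<in>B. t x y j i)"
    by (intro sum.cong refl) (rule sum.swap)
  also have "\<dots> = (\<Sum>j\<in>C. \<Sum>i\<in>D. \<Sum>x\<in>A. \<Sum>y\<in>B. t x y j i)"
    by (intro sum.cong refl) (rule sum.swap)
  finally show ?thesis .
qed

text \<open>The inner product <w_j|u_i> of two columns, that is, the entry (j, i) of W* U.\<close>

definition overlap :: "nat \<Rightarrow> complex mat \<Rightarrow> complex mat \<Rightarrow> nat \<Rightarrow> nat \<Rightarrow> complex" where
  "overlap n W U j i = (\<Sum>a<n. cnj (W $$ (a, j)) * U $$ (a, i))"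

text \<open>The explicit two-sided inverse rules out the result \<open>None\<close>, for which
  \<open>the\<close> is unspecified, and identifies the other result by uniqueness of
  inverses.\<close>

lemma the_mat_inverse_unitary_diag:
  assumes U: "unitary_mat n U" and p: "\<And>i. i < n \<Longrightarrow> d i \<noteq> 0"
  shows "the (mat_inverse (U * mat_diag n d * mat_adjoint U)) = U * mat_diag n (\<lambda>i. inverse (d i)) * mat_adjoint U"
proof -
  let ?W = "mat_adjoint U"
  let ?A = "U * mat_diag n d * ?W" let ?B = "U * mat_diag n (\<lambda>i. inverse (d i)) * ?W"
  have Uc: "U \<in> carrier_mat n n" "?W \<in> carrier_mat n n" and UU: "?W * U = 1\<^sub>m n" "U * ?W = 1\<^sub>m n"
    using U by (auto simp: unitary_mat_def)
  note [simp] = mult_carrier_mat[of _ n n _ n]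
  have AB: "U * mat_diag n g * ?W * (U * mat_diag n h * ?W) = U * mat_diag n (\<lambda>i. g i * h i) * ?W" for g h
  proof -
    have "U * mat_diag n g * ?W * (U * mat_diag n h * ?W) = U * (mat_diag n g * ((?W * U) * (mat_diag n h * ?W)))"
      using Uc by (simp add: assoc_mult_mat[of _ n n _ n _ n])
    also have "\<dots> = U * ((mat_diag n g * mat_diag n h) * ?W)"
      unfolding UU using Uc by (simp add: assoc_mult_mat[of _ n n _ n _ n] left_mult_one_mat[of _ n n] del: mat_diag_diag)
    finally show ?thesis using Uc by (simp add: assoc_mult_mat[of _ n n _ n _ n])
  qed
  have one: "U * mat_diag n g * ?W = 1\<^sub>m n" if "\<And>i. i < n \<Longrightarrow> g i = 1" for g
  proof -
    have "mat_diag n g = 1\<^sub>m n" using that by (intro eq_matI) (auto simp: mat_diag_def)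
    then show ?thesis using Uc UU by simp
  qed
  have inv: "?A * ?B = 1\<^sub>m n" "?B * ?A = 1\<^sub>m n" unfolding AB by (rule one, simp add: p)+
  have c: "?A \<in> carrier_mat n n" "?B \<in> carrier_mat n n" using Uc by auto
  show ?thesis
  proof (cases "mat_inverse ?A")
    case None
    from mat_inverse(1)[OF c(1) None, of undefined] inv c show ?thesis
      by (auto simp: Units_def ring_mat_def)
  next
    case (Some X)
    from mat_inverse(2)[OF c(1) Some] have X: "X * ?A = 1\<^sub>m n" "X \<in> carrier_mat n n" by auto
    have "X = X * (?A * ?B)" using X by (simp add: inv)
    also have "\<dots> = ?B" unfolding assoc_mult_mat[OF X(2) c, symmetric] X(1) by (rule left_mult_one_mat[OF c(2)])
    finally show ?thesis by (simp add: Some)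
  qed
qed

text \<open>The tensor products of w_j with the conjugate of u_i form an orthonormal eigenbasis of
  the Kronecker product, with eigenvalues q_j / p_i. In it the vector of sqrt \<rho> has the
  coordinates sqrt(p_i) <w_j|u_i>.\<close>

lemma quantum_f_rel_entropy_spectral:
  fixes p q :: "nat \<Rightarrow> real"
  assumes U: "unitary_mat n U" and W: "unitary_mat n W" and p: "\<And>i. i < n \<Longrightarrow> 0 < p i"
    and \<rho>: "\<rho> = U * mat_diag n (\<lambda>i. complex_of_real (p i)) * mat_adjoint U"
    and \<sigma>: "\<sigma> = W * mat_diag n (\<lambda>i. complex_of_real (q i)) * mat_adjoint W"
  shows "quantum_f_rel_entropy f \<rho> \<sigma>
    = (\<Sum>j<n. \<Sum>i<n. f (q j / p i) * (p i * (cmod (overlap n W U j i))\<^sup>2))"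
proof -
  have Uc: "U \<in> carrier_mat n n" and Wc: "W \<in> carrier_mat n n" using U W by (auto simp: unitary_mat_def)
  note [simp] = mult_carrier_mat[of _ n n _ n]
  define R where "R = transpose_mat (the (mat_inverse \<rho>))"
  have inv: "the (mat_inverse \<rho>) = U * mat_diag n (\<lambda>i. inverse (complex_of_real (p i))) * mat_adjoint U"
    unfolding \<rho> using p by (intro the_mat_inverse_unitary_diag[OF U]) force
  have R: "R \<in> carrier_mat n n" using Uc by (simp add: R_def inv)
  have Ri: "R $$ (a, b) = (\<Sum>k<n. U $$ (b, k) * inverse (complex_of_real (p k)) * cnj (U $$ (a, k)))" if "a < n" "b < n" for a b
    using that Uc unfolding R_def inv index_unitary_diag[OF Uc that(2,1), symmetric] by (simp del: index_mult_mat(1))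
  have \<sigma>c: "\<sigma> \<in> carrier_mat n n" using Wc by (simp add: \<sigma>)
  \<comment> \<open>The conjugate appears because the transpose of the Hermitian inverse of \<rho>
    is its complex conjugate. Column m belongs to the pair j = m div n, i = m mod n.\<close>
  define Z where "Z = Matrix.mat (n * n) (n * n) (\<lambda>(k, m). W $$ (k div n, m div n) * cnj (U $$ (k mod n, m mod n)))"
  have Z: "Z \<in> carrier_mat (n * n) (n * n)" by (simp add: Z_def)
  have dm: "k div n < n" "k mod n < n" if "k < n * n" for k
    using that by (auto simp: less_mult_imp_div_less intro!: mod_less_divisor) (metis gr0I mult_0_right not_less_zero)
  have dm_eq: "k = l \<longleftrightarrow> k div n = l div n \<and> k mod n = l mod n" for k l :: nat
    by (metis div_mult_mod_eq)
  have Zu: "unitary_mat (n * n) Z"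
  proof (rule unitary_matI_left[OF Z])
    fix i j assume ij: "i < n * n" "j < n * n"
    have "(\<Sum>k<n * n. cnj (Z $$ (k, i)) * Z $$ (k, j)) =
      (\<Sum>k<n * n. (cnj (W $$ (k div n, i div n)) * W $$ (k div n, j div n)) *
        (U $$ (k mod n, i mod n) * cnj (U $$ (k mod n, j mod n))))"
      using ij by (intro sum.cong refl) (auto simp: Z_def mult_ac)
    also have "\<dots> = (\<Sum>a<n. cnj (W $$ (a, i div n)) * W $$ (a, j div n)) *
        (\<Sum>b<n. U $$ (b, i mod n) * cnj (U $$ (b, j mod n)))"
      unfolding sum_product by (rule sum_div_mod)
    also have "(\<Sum>b<n. U $$ (b, i mod n) * cnj (U $$ (b, j mod n))) = (if i mod n = j mod n then 1 else 0)"
      using unitary_columns[OF U dm(2)[OF ij(2)] dm(2)[OF ij(1)]] by (auto simp: mult.commute)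
    finally show "(\<Sum>k<n * n. cnj (Z $$ (k, i)) * Z $$ (k, j)) = (if i = j then 1 else 0)"
      unfolding dm_eq[of i j] using unitary_columns[OF W dm(1)[OF ij(1)] dm(1)[OF ij(2)]] by auto
  qed
  define r where "r m = q (m div n) / p (m mod n)" for m
  have K: "kronecker_mat \<sigma> R = Z * mat_diag (n * n) (\<lambda>m. complex_of_real (r m)) * mat_adjoint Z"
  proof (rule unitary_diag_eqI[OF Z])
    show "kronecker_mat \<sigma> R \<in> carrier_mat (n * n) (n * n)" using \<sigma>c R by (simp add: kronecker_mat_def)
    fix k l assume kl: "k < n * n" "l < n * n"
    have "kronecker_mat \<sigma> R $$ (k, l) = \<sigma> $$ (k div n, l div n) * R $$ (k mod n, l mod n)"
      using \<sigma>c R kl by (simp add: kronecker_mat_def)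
    also have "\<dots> = (\<Sum>j<n. W $$ (k div n, j) * q j * cnj (W $$ (l div n, j))) *
       (\<Sum>i<n. U $$ (l mod n, i) * inverse (complex_of_real (p i)) * cnj (U $$ (k mod n, i)))"
      unfolding \<sigma> using dm[OF kl(1)] dm[OF kl(2)] by (simp add: index_unitary_diag[OF Wc] Ri del: index_mult_mat(1))
    also have "\<dots> = (\<Sum>m<n * n. (W $$ (k div n, m div n) * q (m div n) * cnj (W $$ (l div n, m div n))) *
      (U $$ (l mod n, m mod n) * inverse (complex_of_real (p (m mod n))) * cnj (U $$ (k mod n, m mod n))))"
      unfolding sum_product by (rule sum_div_mod[symmetric])
    also have "\<dots> = (\<Sum>m<n * n. Z $$ (k, m) * complex_of_real (r m) * cnj (Z $$ (l, m)))"
      using kl by (intro sum.cong refl) (simp add: Z_def r_def divide_inverse mult_ac)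
    finally show "kronecker_mat \<sigma> R $$ (k, l) = (\<Sum>m<n * n. Z $$ (k, m) * complex_of_real (r m) * cnj (Z $$ (l, m)))" .
  qed
  have M: "mat_real_fun f (kronecker_mat \<sigma> R) = Z * mat_diag (n * n) (\<lambda>m. complex_of_real (f (r m))) * mat_adjoint Z"
    unfolding K mat_fun_unitary_diag[OF Zu] by simp
  define v where "v = vec_of_rows (mat_real_fun sqrt \<rho>)"
  have sq: "mat_real_fun sqrt \<rho> = U * mat_diag n (\<lambda>i. complex_of_real (sqrt (p i))) * mat_adjoint U"
    unfolding \<rho> mat_fun_unitary_diag[OF U] by simp
  then have sqc: "mat_real_fun sqrt \<rho> \<in> carrier_mat n n" using Uc by simp
  have v: "v \<in> carrier_vec (n * n)" using sqc by (simp add: v_def vec_of_rows_def)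
  have vi: "v $ k = (\<Sum>l<n. U $$ (k div n, l) * sqrt (p l) * cnj (U $$ (k mod n, l)))" if "k < n * n" for k
    unfolding index_unitary_diag[OF Uc dm[OF that], symmetric] sq[symmetric]
    using that sqc by (simp add: v_def vec_of_rows_def)
  have Zv: "(mat_adjoint Z *\<^sub>v v) $ m = overlap n W U (m div n) (m mod n) * sqrt (p (m mod n))" if m: "m < n * n" for m
  proof -
    let ?j = "m div n" and ?i = "m mod n"
    have "(mat_adjoint Z *\<^sub>v v) $ m = (\<Sum>k<n * n. cnj (W $$ (k div n, ?j)) * U $$ (k mod n, ?i) *
        (\<Sum>l<n. U $$ (k div n, l) * sqrt (p l) * cnj (U $$ (k mod n, l))))"
      unfolding index_mult_vec_sum[OF adjoint_carrier_rect[OF Z] v m]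
      by (intro sum.cong refl) (simp add: index_adjoint[OF Z] m vi, simp add: Z_def m)
    also have "\<dots> = (\<Sum>a<n. \<Sum>b<n. cnj (W $$ (a, ?j)) * U $$ (b, ?i) * (\<Sum>l<n. U $$ (a, l) * sqrt (p l) * cnj (U $$ (b, l))))"
      by (rule sum_div_mod)
    \<comment> \<open>The sum over \<open>b\<close> is moved inside because it is an inner product
      of two columns of \<open>U\<close> and leaves only l = i.\<close>
    also have "\<dots> = (\<Sum>a<n. cnj (W $$ (a, ?j)) * (\<Sum>l<n. U $$ (a, l) * sqrt (p l) * (\<Sum>b<n. cnj (U $$ (b, l)) * U $$ (b, ?i))))"
      unfolding sum_distrib_left by (subst (2) sum.swap) (simp add: mult_ac)
    also have "\<dots> = (\<Sum>a<n. cnj (W $$ (a, ?j)) * (\<Sum>l<n. if l = ?i then U $$ (a, l) * sqrt (p l) else 0))"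
      using dm[OF m] by (intro sum.cong refl arg_cong2[of _ _ _ _ "(*)"]) (simp add: unitary_columns[OF U])
    also have "\<dots> = overlap n W U ?j ?i * sqrt (p ?i)"
      using dm[OF m] by (simp add: overlap_def sum_distrib_left mult_ac)
    finally show ?thesis .
  qed
  have "quantum_f_rel_entropy f \<rho> \<sigma> = Re ((mat_real_fun f (kronecker_mat \<sigma> R) *\<^sub>v v) \<bullet>c v)"
    by (simp add: quantum_f_rel_entropy_def Let_def v_def R_def)
  also have "\<dots> = (\<Sum>m<n * n. f (q (m div n) / p (m mod n)) * (p (m mod n) * (cmod (overlap n W U (m div n) (m mod n)))\<^sup>2))"
    unfolding M quadratic_form_unitary_diag[OF Z v]
    using p dm by (intro sum.cong refl) (auto simp: Zv r_def norm_mult power_mult_distrib less_imp_le simp del: index_mult_mat_vec)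
  also have "\<dots> = (\<Sum>j<n. \<Sum>i<n. f (q j / p i) * (p i * (cmod (overlap n W U j i))\<^sup>2))"
    by (rule sum_div_mod)
  finally show ?thesis .
qed

section \<open>Spectral form of the traces\<close>

lemma mat_powc_unitary_diag:
  assumes U: "unitary_mat n U"
  shows "mat_powc (U * mat_diag n (\<lambda>i. complex_of_real (p i)) * mat_adjoint U) z
       = U * mat_diag n (\<lambda>i. exp (z * ln (p i))) * mat_adjoint U"
proof -
  have Uc: "U \<in> carrier_mat n n" using U by (auto simp: unitary_mat_def)
  have c: "U * mat_diag n d * mat_adjoint U \<in> carrier_mat n n" for d
    using Uc by (simp add: mult_carrier_mat[of _ n n _ n])
  have "z \<cdot>\<^sub>m (U * mat_diag n d * mat_adjoint U) = U * mat_diag n (\<lambda>i. z * d i) * mat_adjoint U" for d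
  proof (rule unitary_diag_eqI[OF Uc])
    show "z \<cdot>\<^sub>m (U * mat_diag n d * mat_adjoint U) \<in> carrier_mat n n" using c by simp
    fix i j assume ij: "i < n" "j < n"
    then have "(z \<cdot>\<^sub>m (U * mat_diag n d * mat_adjoint U)) $$ (i, j) = z * (U * mat_diag n d * mat_adjoint U) $$ (i, j)"
      using c[of d] by (intro index_smult_mat) auto
    then show "(z \<cdot>\<^sub>m (U * mat_diag n d * mat_adjoint U)) $$ (i, j) = (\<Sum>k<n. U $$ (i, k) * (z * d k) * cnj (U $$ (j, k)))"
      unfolding index_unitary_diag[OF Uc ij] by (simp add: sum_distrib_left mult_ac)
  qed
  then show ?thesis
    unfolding mat_powc_def mat_fun_unitary_diag[OF U] by (simp add: mat_fun_unitary_diag[OF U])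
qed

lemma trace_mult_unitary_diag:
  assumes U: "unitary_mat n U" and W: "unitary_mat n W"
  shows "mat_trace ((W * mat_diag n d * mat_adjoint W) * (U * mat_diag n e * mat_adjoint U))
       = (\<Sum>j<n. \<Sum>i<n. d j * e i * complex_of_real ((cmod (overlap n W U j i))\<^sup>2))"
proof -
  have Uc: "U \<in> carrier_mat n n" and Wc: "W \<in> carrier_mat n n" using U W by (auto simp: unitary_mat_def)
  have c: "U * mat_diag n e * mat_adjoint U \<in> carrier_mat n n" "W * mat_diag n d * mat_adjoint W \<in> carrier_mat n n"
    using Uc Wc by (simp_all add: mult_carrier_mat[of _ n n _ n])
  have "mat_trace ((W * mat_diag n d * mat_adjoint W) * (U * mat_diag n e * mat_adjoint U)) =
     (\<Sum>x<n. \<Sum>y<n. (\<Sum>j<n. W $$ (x, j) * d j * cnj (W $$ (y, j))) * (\<Sum>i<n. U $$ (y, i) * e i * cnj (U $$ (x, i))))"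
    using carrier_matD[OF c(2)] unfolding mat_trace_def
    by (intro sum.cong) (auto simp: index_mult_sum[OF c(2,1)] index_unitary_diag[OF Uc] index_unitary_diag[OF Wc] simp del: index_mult_mat(1))
  also have "\<dots> = (\<Sum>j<n. \<Sum>i<n. \<Sum>x<n. \<Sum>y<n. (W $$ (x, j) * d j * cnj (W $$ (y, j))) * (U $$ (y, i) * e i * cnj (U $$ (x, i))))"
    unfolding sum_product by (rule sum_swap_pairs)
  also have "\<dots> = (\<Sum>j<n. \<Sum>i<n. d j * e i * (cnj (overlap n W U j i) * overlap n W U j i))"
    by (intro sum.cong refl) (simp add: overlap_def sum_product sum_distrib_left mult_ac)
  finally show ?thesis by (simp add: complex_norm_square[unfolded of_real_power] mult.commute)
qed

text \<open>Since q^z p^(1-z) = p (q/p)^z, the trace is the spectral sum of the relative entropy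
  with t^z in place of f. Entropies and traces thus integrate different functions against the same
  measure.\<close>

lemma trace_powc_spectral:
  fixes p q :: "nat \<Rightarrow> real"
  assumes U: "unitary_mat n U" and W: "unitary_mat n W"
    and p: "\<And>i. i < n \<Longrightarrow> 0 < p i" and q: "\<And>i. i < n \<Longrightarrow> 0 < q i"
    and \<rho>: "\<rho> = U * mat_diag n (\<lambda>i. complex_of_real (p i)) * mat_adjoint U"
    and \<sigma>: "\<sigma> = W * mat_diag n (\<lambda>i. complex_of_real (q i)) * mat_adjoint W"
  shows "mat_trace (mat_powc \<sigma> z * mat_powc \<rho> (- z + 1))
    = (\<Sum>j<n. \<Sum>i<n. exp (z * ln (q j / p i)) * complex_of_real (p i * (cmod (overlap n W U j i))\<^sup>2))"
proof -
  have e: "exp (z * ln (q j)) * exp ((- z + 1) * ln (p i)) = exp (z * ln (q j / p i)) * p i" if "i < n" "j < n" for i j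
  proof -
    have "z * ln (q j) + (- z + 1) * ln (p i) = z * ln (q j / p i) + complex_of_real (ln (p i))"
      using p[OF that(1)] q[OF that(2)] by (simp add: ln_div algebra_simps)
    then have "exp (z * ln (q j)) * exp ((- z + 1) * ln (p i)) = exp (z * ln (q j / p i)) * exp (complex_of_real (ln (p i)))"
      by (simp only: flip: exp_add)
    then show ?thesis using p[OF that(1)] by (simp add: exp_of_real)
  qed
  show ?thesis
    unfolding \<rho> \<sigma> mat_powc_unitary_diag[OF U] mat_powc_unitary_diag[OF W] trace_mult_unitary_diag[OF U W]
    by (intro sum.cong refl, subst e) auto
qed

section \<open>The isometry of a mixture\<close>

lemma cnj_overlap: "cnj (overlap n W U j i) = overlap n U W i j"
  by (simp add: overlap_def mult.commute)

lemma overlap_self: "unitary_mat n U \<Longrightarrow> i < n \<Longrightarrow> j < n \<Longrightarrow> overlap n U U i j = (if i = j then 1 else 0)"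
  by (simp add: overlap_def unitary_columns)

text \<open>Completeness of the basis \<open>B\<close>: the projections |b_j><b_j| sum to the
  identity.\<close>

lemma overlap_compose:
  assumes B: "unitary_mat n B"
  shows "(\<Sum>j<n. overlap n A B i j * overlap n B C j k) = overlap n A C i k"
proof -
  have "(\<Sum>j<n. overlap n A B i j * overlap n B C j k)
    = (\<Sum>j<n. \<Sum>a<n. \<Sum>b<n. cnj (A $$ (a, i)) * B $$ (a, j) * (cnj (B $$ (b, j)) * C $$ (b, k)))"
    by (simp add: overlap_def sum_product)
  also have "\<dots> = (\<Sum>a<n. \<Sum>j<n. \<Sum>b<n. cnj (A $$ (a, i)) * B $$ (a, j) * (cnj (B $$ (b, j)) * C $$ (b, k)))"
    by (rule sum.swap)
  also have "\<dots> = (\<Sum>a<n. \<Sum>b<n. \<Sum>j<n. cnj (A $$ (a, i)) * B $$ (a, j) * (cnj (B $$ (b, j)) * C $$ (b, k)))"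
    by (rule sum.cong[OF refl], rule sum.swap)
  also have "\<dots> = (\<Sum>a<n. \<Sum>b<n. cnj (A $$ (a, i)) * C $$ (b, k) * (\<Sum>j<n. B $$ (a, j) * cnj (B $$ (b, j))))"
    by (simp add: sum_distrib_left mult_ac)
  also have "\<dots> = (\<Sum>a<n. \<Sum>b<n. if b = a then cnj (A $$ (a, i)) * C $$ (b, k) else 0)"
    by (intro sum.cong refl) (simp add: unitary_rows[OF B])
  finally show ?thesis by (simp add: overlap_def)
qed

text \<open>The entry <w_j|A|w_m> of W* A W.\<close>

definition sandwich :: "nat \<Rightarrow> complex mat \<Rightarrow> complex mat \<Rightarrow> nat \<Rightarrow> nat \<Rightarrow> complex" where
  "sandwich n W A j m = (\<Sum>a<n. \<Sum>b<n. cnj (W $$ (a, j)) * A $$ (a, b) * W $$ (b, m))"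

lemma sandwich_unitary_diag:
  assumes U: "U \<in> carrier_mat n n"
  shows "sandwich n W (U * mat_diag n d * mat_adjoint U) j m = (\<Sum>k<n. overlap n W U j k * d k * overlap n U W k m)"
proof -
  have "(\<Sum>k<n. overlap n W U j k * d k * overlap n U W k m)
    = (\<Sum>k<n. \<Sum>a<n. \<Sum>b<n. cnj (W $$ (a, j)) * U $$ (a, k) * (cnj (U $$ (b, k)) * W $$ (b, m)) * d k)"
    by (simp add: overlap_def sum_product sum_distrib_right[symmetric] mult_ac)
       (simp add: sum_product sum_distrib_left mult_ac)
  also have "\<dots> = (\<Sum>a<n. \<Sum>k<n. \<Sum>b<n. cnj (W $$ (a, j)) * U $$ (a, k) * (cnj (U $$ (b, k)) * W $$ (b, m)) * d k)"
    by (rule sum.swap)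
  also have "\<dots> = (\<Sum>a<n. \<Sum>b<n. \<Sum>k<n. cnj (W $$ (a, j)) * U $$ (a, k) * (cnj (U $$ (b, k)) * W $$ (b, m)) * d k)"
    by (rule sum.cong[OF refl], rule sum.swap)
  also have "\<dots> = sandwich n W (U * mat_diag n d * mat_adjoint U) j m"
    unfolding sandwich_def
    by (intro sum.cong refl) (simp add: index_unitary_diag[OF U] sum_distrib_left sum_distrib_right mult_ac del: index_mult_mat(1))
  finally show ?thesis by simp
qed

lemma sandwich_combination:
  assumes "A \<in> carrier_mat n n" "B \<in> carrier_mat n n"
  shows "sandwich n W (mat_combination \<mu> A B) j m = \<mu> * sandwich n W A j m + (1 - \<mu>) * sandwich n W B j m"
  using assms unfolding sandwich_def mat_combination_def sum_distrib_left sum.distrib[symmetric]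
  by (intro sum.cong refl) (simp add: algebra_simps)

text \<open>Reads the equation of the mixture in the eigenbasis of the mixture itself, where one
  side is diagonal. \<open>spectral_mixture\<close> assumes the equations for \<rho> and \<sigma> in
  this form.\<close>

lemma combination_spectral_overlap:
  fixes p p1 p2 :: "nat \<Rightarrow> real"
  assumes U: "unitary_mat n U" "unitary_mat n U1" "unitary_mat n U2"
    and eq: "U * mat_diag n (\<lambda>i. complex_of_real (p i)) * mat_adjoint U = mat_combination \<mu>
      (U1 * mat_diag n (\<lambda>i. complex_of_real (p1 i)) * mat_adjoint U1)
      (U2 * mat_diag n (\<lambda>i. complex_of_real (p2 i)) * mat_adjoint U2)"
    and ij: "i < n" "j < n"
  shows "\<mu> * (\<Sum>k<n. overlap n U U1 i k * p1 k * overlap n U1 U k j)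
    + (1 - \<mu>) * (\<Sum>k<n. overlap n U U2 i k * p2 k * overlap n U2 U k j) = (if i = j then complex_of_real (p i) else 0)"
proof -
  have c: "U \<in> carrier_mat n n" "U1 \<in> carrier_mat n n" "U2 \<in> carrier_mat n n" using U by (auto simp: unitary_mat_def)
  have c': "U1 * mat_diag n (\<lambda>i. complex_of_real (p1 i)) * mat_adjoint U1 \<in> carrier_mat n n"
    "U2 * mat_diag n (\<lambda>i. complex_of_real (p2 i)) * mat_adjoint U2 \<in> carrier_mat n n"
    using c by (auto simp: mult_carrier_mat[of _ n n _ n])
  have "(if i = j then complex_of_real (p i) else 0) = (\<Sum>k<n. if k = i then (if i = j then complex_of_real (p i) else 0) else 0)"
    using ij by simp
  also have "\<dots> = (\<Sum>k<n. overlap n U U i k * p k * overlap n U U k j)"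
    using ij by (intro sum.cong refl) (auto simp: overlap_self[OF U(1)])
  also have "\<dots> = sandwich n U (mat_combination \<mu>
      (U1 * mat_diag n (\<lambda>i. complex_of_real (p1 i)) * mat_adjoint U1)
      (U2 * mat_diag n (\<lambda>i. complex_of_real (p2 i)) * mat_adjoint U2)) i j"
    unfolding eq[symmetric] by (rule sandwich_unitary_diag[OF c(1), symmetric])
  finally show ?thesis
    unfolding sandwich_combination[OF c'] sandwich_unitary_diag[OF c(2)] sandwich_unitary_diag[OF c(3)] by simp
qed

lemma pos_def_spectral:
  assumes "pos_def_mat n A"
  shows "\<exists>U (p :: nat \<Rightarrow> real). unitary_mat n U \<and>
    A = U * mat_diag n (\<lambda>i. complex_of_real (p i)) * mat_adjoint U \<and> (\<forall>i<n. 0 < p i)"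
proof -
  obtain U p where U: "unitary_mat n U" and A: "A = U * mat_diag n (\<lambda>i. complex_of_real (p i)) * mat_adjoint U"
    using hermitian_spectral assms unfolding pos_def_mat_def by blast
  have Uc: "U \<in> carrier_mat n n" using U by (simp add: unitary_mat_def)
  have "0 < p k" if k: "k < n" for k
  proof -
    \<comment> \<open>Testing positivity on the k-th eigenvector returns \<open>p k\<close>.\<close>
    define v where "v = col U k"
    have v: "v \<in> carrier_vec n" using Uc by (auto simp: v_def)
    have Uv: "(mat_adjoint U *\<^sub>v v) $ i = (if i = k then 1 else 0)" if "i < n" for i
      unfolding index_mult_vec_sum[OF adjoint_carrier_rect[OF Uc] v that] unitary_columns[OF U that k, symmetric]
      using that Uc k by (intro sum.cong refl) (simp add: index_adjoint[OF Uc] v_def)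
    have "v \<noteq> 0\<^sub>v n"
    proof
      assume "v = 0\<^sub>v n"
      then have "(mat_adjoint U *\<^sub>v v) $ k = 0"
        unfolding index_mult_vec_sum[OF adjoint_carrier_rect[OF Uc] v k] by simp
      with Uv[OF k] show False by simp
    qed
    then have "0 < Re ((A *\<^sub>v v) \<bullet>c v)" using assms v by (simp add: pos_def_mat_def)
    also have "\<dots> = (\<Sum>i<n. if i = k then p i else 0)"
      unfolding A quadratic_form_unitary_diag[OF Uc v]
      by (intro sum.cong refl) (auto simp: Uv simp del: index_mult_mat_vec)
    finally show ?thesis using k by simp
  qed
  with U A show ?thesis by blast
qed

lemma pos_def_combination:
  assumes l: "0 < l" "l < 1" and A: "pos_def_mat n A" and B: "pos_def_mat n B"
  shows "pos_def_mat n (mat_combination l A B)"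
proof -
  have h: "hermitian_mat n A" "hermitian_mat n B" using A B by (auto simp: pos_def_mat_def)
  then have c: "A \<in> carrier_mat n n" "B \<in> carrier_mat n n" by (auto simp: hermitian_mat_def)
  have "0 < Re ((mat_combination l A B *\<^sub>v v) \<bullet>c v)" if v: "v \<in> carrier_vec n" "v \<noteq> 0\<^sub>v n" for v
  proof -
    have "mat_combination l A B - 0\<^sub>m n n = mat_combination l A B"
      using c by (intro eq_matI) (auto simp: mat_combination_def)
    moreover have "0\<^sub>m n n *\<^sub>v v = 0\<^sub>v n" using v by (intro eq_vecI) auto
    ultimately have "Re ((mat_combination l A B *\<^sub>v v) \<bullet>c v) = l * Re ((A *\<^sub>v v) \<bullet>c v) + (1 - l) * Re ((B *\<^sub>v v) \<bullet>c v)"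
      using quadratic_form_combination[OF c zero_carrier_mat v(1), of l] v by simp
    also have "\<dots> > 0" using A B v l by (intro add_pos_pos mult_pos_pos) (auto simp: pos_def_mat_def)
    finally show ?thesis .
  qed
  with hermitian_combination[OF h] show ?thesis by (simp add: pos_def_mat_def)
qed

text \<open>With \<open>b\<close> labelling the two summands, \<open>V b\<close> is the matrix of the map \<open>X \<mapsto> \<surd>\<lambda>\<^sub>b X \<rho>\<^sup>-\<^sup>1\<^sup>/\<^sup>2 \<rho>\<^sub>b\<^sup>1\<^sup>/\<^sup>2\<close>
  with respect to the bases \<open>|j\<^sub>\<sigma>\<rangle>\<langle>i\<^sub>\<rho>|\<close>. Together these maps form an isometry that takes
  \<open>\<surd>\<rho>\<close> to the pair of \<open>\<surd>\<lambda>\<^sub>b \<surd>\<rho>\<^sub>b\<close> and compresses the modular operators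
  \<open>X \<mapsto> \<sigma>\<^sub>b X \<rho>\<^sub>b\<^sup>-\<^sup>1\<close> to \<open>X \<mapsto> \<sigma> X \<rho>\<^sup>-\<^sup>1\<close>.\<close>

locale spectral_mixture =
  fixes n :: nat and wt :: "bool \<Rightarrow> real"
    and U W :: "complex mat" and p q :: "nat \<Rightarrow> real"
    and Us Ws :: "bool \<Rightarrow> complex mat" and ps qs :: "bool \<Rightarrow> nat \<Rightarrow> real"
  assumes U: "unitary_mat n U" and W: "unitary_mat n W"
    and Us: "\<And>b. unitary_mat n (Us b)" and Ws: "\<And>b. unitary_mat n (Ws b)"
    and wt_pos: "\<And>b. 0 < wt b" and wt_sum: "wt True + wt False = 1"
    and p: "\<And>i. i < n \<Longrightarrow> 0 < p i" and ps: "\<And>b i. i < n \<Longrightarrow> 0 < ps b i"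
    and mix_p: "\<And>i j. i < n \<Longrightarrow> j < n \<Longrightarrow>
      (\<Sum>b\<in>UNIV. wt b * (\<Sum>k<n. overlap n U (Us b) i k * ps b k * overlap n (Us b) U k j)) = (if i = j then complex_of_real (p i) else 0)"
    and mix_q: "\<And>i j. i < n \<Longrightarrow> j < n \<Longrightarrow>
      (\<Sum>b\<in>UNIV. wt b * (\<Sum>k<n. overlap n W (Ws b) i k * qs b k * overlap n (Ws b) W k j)) = (if i = j then complex_of_real (q i) else 0)"
begin

definition L :: "(nat \<times> nat) set" where "L = {..<n} \<times> {..<n}"
definition K :: "(bool \<times> nat \<times> nat) set" where "K = UNIV \<times> {..<n} \<times> {..<n}"
definition V :: "bool \<times> nat \<times> nat \<Rightarrow> nat \<times> nat \<Rightarrow> complex" where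
  "V = (\<lambda>(b, j', i') (j, i). complex_of_real (sqrt (wt b) * sqrt (ps b i') / sqrt (p i))
     * overlap n (Ws b) W j' j * overlap n U (Us b) i i')"
definition d :: "bool \<times> nat \<times> nat \<Rightarrow> real" where "d = (\<lambda>(b, j, i). qs b j / ps b i)"
definition e :: "nat \<times> nat \<Rightarrow> real" where "e = (\<lambda>(j, i). q j / p i)"
text \<open>The coordinates <j_\<sigma>| sqrt \<rho> |i_\<rho>> of sqrt \<rho> in the same basis as
  for \<open>V\<close>.\<close>

definition x :: "nat \<times> nat \<Rightarrow> complex" where "x = (\<lambda>(j, i). complex_of_real (sqrt (p i)) * overlap n W U j i)"

lemma finite_K: "finite K" and finite_L: "finite L"
  by (simp_all add: K_def L_def)

lemma sum_L: "(\<Sum>l\<in>L. g l) = (\<Sum>j<n. \<Sum>i<n. g (j, i))"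
  by (simp add: L_def sum.cartesian_product)

lemma sum_K: "(\<Sum>k\<in>K. g k) = (\<Sum>b\<in>UNIV. \<Sum>j<n. \<Sum>i<n. g (b, j, i))"
  by (simp add: K_def sum.cartesian_product)

text \<open>The common computation behind isometry and compression. The square roots of
  \<open>ps\<close> in the two copies of \<open>V\<close> cancel the denominator, and for each
  \<open>b\<close> the sum factors into a part for \<sigma> and a part for \<rho>. The isometry is
  the case g = 1, g' = ps, the compression the case g = qs, g' = 1.\<close>

lemma V_gram:
  assumes l: "i < n" "h < n"
  shows "(\<Sum>k\<in>K. cnj (V k (j, i)) * complex_of_real (case k of (b, j', i') \<Rightarrow> g b j' * g' b i' / ps b i') * V k (m, h))
    = (\<Sum>b\<in>UNIV. wt b * (\<Sum>j'<n. overlap n W (Ws b) j j' * g b j' * overlap n (Ws b) W j' m)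
        * (\<Sum>i'<n. overlap n U (Us b) h i' * g' b i' * overlap n (Us b) U i' i)) / (sqrt (p i) * sqrt (p h))"
proof -
  have "cnj (V (b, j', i') (j, i)) * complex_of_real (g b j' * g' b i' / ps b i') * V (b, j', i') (m, h)
    = wt b / (sqrt (p i) * sqrt (p h)) * ((overlap n W (Ws b) j j' * g b j' * overlap n (Ws b) W j' m)
      * (overlap n U (Us b) h i' * g' b i' * overlap n (Us b) U i' i))" if "i' < n" for b j' i'
  proof -
    have "sqrt (wt b) * sqrt (ps b i') / sqrt (p i) * (g b j' * g' b i' / ps b i') * (sqrt (wt b) * sqrt (ps b i') / sqrt (p h))
      = (sqrt (wt b) * sqrt (wt b)) * (sqrt (ps b i') * sqrt (ps b i') / ps b i')
         * (g b j' * g' b i') / (sqrt (p i) * sqrt (p h))"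
      by (simp add: mult_ac del: real_sqrt_mult_self)
    also have "\<dots> = wt b * (g b j' * g' b i') / (sqrt (p i) * sqrt (p h))"
      using wt_pos[of b] ps[OF that, of b] by simp
    finally have s: "complex_of_real (sqrt (wt b) * sqrt (ps b i') / sqrt (p i)) * complex_of_real (g b j' * g' b i' / ps b i')
       * complex_of_real (sqrt (wt b) * sqrt (ps b i') / sqrt (p h))
      = complex_of_real (wt b * (g b j' * g' b i') / (sqrt (p i) * sqrt (p h)))"
      by (simp only: of_real_mult[symmetric])
    have "cnj (V (b, j', i') (j, i)) * complex_of_real (g b j' * g' b i' / ps b i') * V (b, j', i') (m, h)
      = (complex_of_real (sqrt (wt b) * sqrt (ps b i') / sqrt (p i)) * complex_of_real (g b j' * g' b i' / ps b i')
          * complex_of_real (sqrt (wt b) * sqrt (ps b i') / sqrt (p h)))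
        * (overlap n W (Ws b) j j' * overlap n (Us b) U i' i * overlap n (Ws b) W j' m * overlap n U (Us b) h i')"
      by (simp add: V_def cnj_overlap)
    then show ?thesis unfolding s by (simp add: mult_ac)
  qed
  then have "(\<Sum>k\<in>K. cnj (V k (j, i)) * complex_of_real (case k of (b, j', i') \<Rightarrow> g b j' * g' b i' / ps b i') * V k (m, h))
    = (\<Sum>b\<in>UNIV. \<Sum>j'<n. \<Sum>i'<n. wt b / (sqrt (p i) * sqrt (p h)) * ((overlap n W (Ws b) j j' * g b j' * overlap n (Ws b) W j' m)
      * (overlap n U (Us b) h i' * g' b i' * overlap n (Us b) U i' i)))"
    unfolding sum_K by (intro sum.cong refl) simp
  also have "\<dots> = (\<Sum>b\<in>UNIV. wt b / (sqrt (p i) * sqrt (p h)) * ((\<Sum>j'<n. overlap n W (Ws b) j j' * g b j' * overlap n (Ws b) W j' m)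
      * (\<Sum>i'<n. overlap n U (Us b) h i' * g' b i' * overlap n (Us b) U i' i)))"
    unfolding sum_product unfolding sum_distrib_left ..
  finally show ?thesis by (simp add: sum_divide_distrib mult_ac)
qed

text \<open>V* V is right multiplication by the weighted sum of the components of \<rho>, conjugated
  by \<rho>^(-1/2). By \<open>mix_p\<close> that sum is \<rho>.\<close>

lemma V_isometry:
  assumes "l \<in> L" "m \<in> L"
  shows "(\<Sum>k\<in>K. cnj (V k l) * V k m) = (if l = m then 1 else 0)"
proof -
  obtain j i j' i' where lm: "l = (j, i)" "m = (j', i')" and b: "j < n" "i < n" "j' < n" "i' < n"
    using assms by (auto simp: L_def)
  have G: "(\<Sum>k<n. overlap n W (Ws b) j k * complex_of_real 1 * overlap n (Ws b) W k j') = (if j = j' then 1 else 0)" for b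
    using overlap_compose[OF Ws, where A = W and C = W] overlap_self[OF W] b by simp
  \<comment> \<open>The inserted factor ps / ps = 1 brings the sum into the form of
    \<open>V_gram\<close>.\<close>
  have "(\<Sum>k\<in>K. cnj (V k l) * V k m)
    = (\<Sum>k\<in>K. cnj (V k (j, i)) * complex_of_real (case k of (b, j', i') \<Rightarrow> 1 * ps b i' / ps b i') * V k (j', i'))"
    unfolding lm
  proof (rule sum.cong[OF refl])
    fix k assume "k \<in> K"
    then have "(case k of (b, j', i') \<Rightarrow> 1 * ps b i' / ps b i') = 1"
      using ps by (auto simp: K_def dest!: order.strict_implies_not_eq[OF ps, symmetric])
    then show "cnj (V k (j, i)) * V k (j', i')
      = cnj (V k (j, i)) * complex_of_real (case k of (b, j', i') \<Rightarrow> 1 * ps b i' / ps b i') * V k (j', i')"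
      by simp
  qed
  also have "\<dots> = (\<Sum>b\<in>UNIV. wt b * (\<Sum>k<n. overlap n W (Ws b) j k * complex_of_real 1 * overlap n (Ws b) W k j')
        * (\<Sum>k<n. overlap n U (Us b) i' k * ps b k * overlap n (Us b) U k i)) / (sqrt (p i) * sqrt (p i'))"
    by (rule V_gram) fact+
  also have "(\<Sum>b\<in>UNIV. wt b * (\<Sum>k<n. overlap n W (Ws b) j k * complex_of_real 1 * overlap n (Ws b) W k j') * (\<Sum>k<n. overlap n U (Us b) i' k * ps b k * overlap n (Us b) U k i))
    = (if j = j' then 1 else 0) * (if i' = i then complex_of_real (p i') else 0)"
    unfolding G unfolding mix_p[OF b(4,2), symmetric] sum_distrib_left by (intro sum.cong refl) (simp add: mult_ac)
  finally show ?thesis using lm p[OF b(2)] by (auto simp flip: of_real_mult)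
qed

text \<open>Between V* and V the powers of the component of \<rho> cancel, and the summand of
  \<open>b\<close> multiplies from the left by the weighted component of \<sigma> and from the right
  by \<rho>^(-1). By \<open>mix_q\<close> the sum over \<open>b\<close> is the modular operator of
  the mixture.\<close>

lemma V_compression:
  assumes "l \<in> L" "m \<in> L"
  shows "(\<Sum>k\<in>K. cnj (V k l) * d k * V k m) = (if l = m then complex_of_real (e l) else 0)"
proof -
  obtain j i j' i' where lm: "l = (j, i)" "m = (j', i')" and b: "j < n" "i < n" "j' < n" "i' < n"
    using assms by (auto simp: L_def)
  have G: "(\<Sum>k<n. overlap n U (Us b) i' k * complex_of_real 1 * overlap n (Us b) U k i) = (if i' = i then 1 else 0)" for b
    using overlap_compose[OF Us, where A = U and C = U] overlap_self[OF U] b by simp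
  have "(\<Sum>k\<in>K. cnj (V k l) * d k * V k m)
    = (\<Sum>k\<in>K. cnj (V k (j, i)) * complex_of_real (case k of (b, j', i') \<Rightarrow> qs b j' * 1 / ps b i') * V k (j', i'))"
    unfolding lm d_def by (intro sum.cong refl) auto
  also have "\<dots> = (\<Sum>b\<in>UNIV. wt b * (\<Sum>k<n. overlap n W (Ws b) j k * qs b k * overlap n (Ws b) W k j')
        * (\<Sum>k<n. overlap n U (Us b) i' k * complex_of_real 1 * overlap n (Us b) U k i)) / (sqrt (p i) * sqrt (p i'))"
    by (rule V_gram) fact+
  also have "(\<Sum>b\<in>UNIV. wt b * (\<Sum>k<n. overlap n W (Ws b) j k * qs b k * overlap n (Ws b) W k j') * (\<Sum>k<n. overlap n U (Us b) i' k * complex_of_real 1 * overlap n (Us b) U k i))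
    = (if i' = i then 1 else 0) * (if j = j' then complex_of_real (q j) else 0)"
    unfolding G unfolding mix_q[OF b(1,3), symmetric] sum_distrib_left by (intro sum.cong refl) (simp add: mult_ac)
  finally show ?thesis using lm p[OF b(2)] by (auto simp: e_def simp flip: of_real_mult of_real_divide)
qed

text \<open>The factor \<rho>^(-1/2) of \<open>V\<close> cancels the sqrt \<rho> whose coordinates
  are \<open>x\<close>; the remaining changes of basis collapse by completeness.\<close>

lemma V_x:
  assumes "j' < n" "i' < n"
  shows "(\<Sum>l\<in>L. V (b, j', i') l * x l) = complex_of_real (sqrt (wt b) * sqrt (ps b i')) * overlap n (Ws b) (Us b) j' i'"
proof -
  have "(\<Sum>l\<in>L. V (b, j', i') l * x l) = (\<Sum>j<n. \<Sum>i<n. complex_of_real (sqrt (wt b) * sqrt (ps b i'))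
      * (overlap n (Ws b) W j' j * (overlap n W U j i * overlap n U (Us b) i i')))"
    unfolding sum_L
  proof (intro sum.cong refl)
    fix j i assume "i \<in> {..<n}"
    then have "complex_of_real (sqrt (p i)) \<noteq> 0" using p[of i] by simp
    then show "V (b, j', i') (j, i) * x (j, i) = complex_of_real (sqrt (wt b) * sqrt (ps b i'))
      * (overlap n (Ws b) W j' j * (overlap n W U j i * overlap n U (Us b) i i'))"
      by (simp add: V_def x_def)
  qed
  also have "\<dots> = complex_of_real (sqrt (wt b) * sqrt (ps b i')) * (\<Sum>j<n. overlap n (Ws b) W j' j * (\<Sum>i<n. overlap n W U j i * overlap n U (Us b) i i'))"
    unfolding sum_distrib_left ..
  finally show ?thesis by (simp add: overlap_compose[OF U] overlap_compose[OF W])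
qed

lemma norm_x: "j < n \<Longrightarrow> i < n \<Longrightarrow> (cmod (x (j, i)))\<^sup>2 = p i * (cmod (overlap n W U j i))\<^sup>2"
  using p[of i] by (simp add: x_def norm_mult power_mult_distrib)

lemma norm_V_x:
  assumes "j < n" "i < n"
  shows "(cmod (\<Sum>l\<in>L. V (b, j, i) l * x l))\<^sup>2 = wt b * (ps b i * (cmod (overlap n (Ws b) (Us b) j i))\<^sup>2)"
  unfolding V_x[OF assms] using wt_pos[of b] ps[OF assms(2), of b] by (simp add: norm_mult power_mult_distrib)

text \<open>The type class admits both the real \<open>f\<close> and the complex powers t^z as
  \<open>g\<close>, so entropies and traces are covered together.\<close>

lemma sum_x:
  fixes g :: "real \<Rightarrow> 'v::real_field"
  shows "(\<Sum>l\<in>L. g (e l) * of_real ((cmod (x l))\<^sup>2))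
    = (\<Sum>j<n. \<Sum>i<n. g (q j / p i) * of_real (p i * (cmod (overlap n W U j i))\<^sup>2))"
  unfolding sum_L by (intro sum.cong refl) (simp only: e_def norm_x lessThan_iff prod.case)

lemma sum_V_x:
  fixes g :: "real \<Rightarrow> 'v::real_field"
  shows "(\<Sum>k\<in>K. g (d k) * of_real ((cmod (\<Sum>l\<in>L. V k l * x l))\<^sup>2))
    = (\<Sum>b\<in>UNIV. of_real (wt b) * (\<Sum>j<n. \<Sum>i<n. g (qs b j / ps b i) * of_real (ps b i * (cmod (overlap n (Ws b) (Us b) j i))\<^sup>2)))"
  unfolding sum_K sum_distrib_left
  by (intro sum.cong refl) (simp only: d_def norm_V_x lessThan_iff prod.case, simp add: mult_ac)

end

section \<open>Application to the given matrices\<close>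

lemma spectrum_ratios:
  assumes U: "unitary_mat n U" and W: "unitary_mat n W"
    and \<rho>: "\<rho> = U * mat_diag n (\<lambda>i. complex_of_real (p i)) * mat_adjoint U"
    and \<sigma>: "\<sigma> = W * mat_diag n (\<lambda>i. complex_of_real (q i)) * mat_adjoint W"
    and ratios: "eigenvalue_ratios_in I \<rho> \<sigma>" and ij: "i < n" "j < n"
  shows "q j / p i \<in> I"
proof -
  have "complex_of_real (q j) / complex_of_real (p i) \<in> complex_of_real ` I"
    using ratios ij unfolding eigenvalue_ratios_in_def \<rho> \<sigma> spectrum_unitary_diag[OF U] spectrum_unitary_diag[OF W] by blast
  then show ?thesis by (metis imageE of_real_divide of_real_eq_iff)
qed

theorem lemma6:
  fixes l \<alpha> :: real and n :: nat and I :: "real set" and f :: "real \<Rightarrow> real"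
    and \<rho>1 \<rho>2 \<rho>l \<sigma>1 \<sigma>2 \<sigma>l :: "complex mat"
  assumes l: "0 < l" "l < 1"
    and pos: "pos_def_mat n \<rho>1" "pos_def_mat n \<rho>2" "pos_def_mat n \<sigma>1" "pos_def_mat n \<sigma>2"
    and \<rho>l: "\<rho>l = mat_combination l \<rho>1 \<rho>2"
    and \<sigma>l: "\<sigma>l = mat_combination l \<sigma>1 \<sigma>2"
    and dom: "is_interval I" "I \<subseteq> {0<..<\<alpha>}"
    and ratios: "eigenvalue_ratios_in I \<rho>1 \<sigma>1" "eigenvalue_ratios_in I \<rho>2 \<sigma>2"
      "eigenvalue_ratios_in I \<rho>l \<sigma>l"
    and convex: "operator_convex_on I f"
  shows "quantum_f_rel_entropy f \<rho>l \<sigma>l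
           \<le> l * quantum_f_rel_entropy f \<rho>1 \<sigma>1 + (1 - l) * quantum_f_rel_entropy f \<rho>2 \<sigma>2 \<and>
         (\<forall>t\<^sub>0 a. I = {t\<^sub>0 - a<..<t\<^sub>0 + a} \<longrightarrow> diffused t\<^sub>0 a f \<longrightarrow>
           (quantum_f_rel_entropy f \<rho>l \<sigma>l
              = l * quantum_f_rel_entropy f \<rho>1 \<sigma>1 + (1 - l) * quantum_f_rel_entropy f \<rho>2 \<sigma>2
            \<longleftrightarrow>
            (\<forall>t::complex.
               mat_trace (mat_powc \<sigma>l (\<i> * t) * mat_powc \<rho>l (- \<i> * t + 1))
               = complex_of_real l
                   * mat_trace (mat_powc \<sigma>1 (\<i> * t) * mat_powc \<rho>1 (- \<i> * t + 1))
                 + complex_of_real (1 - l)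
                   * mat_trace (mat_powc \<sigma>2 (\<i> * t) * mat_powc \<rho>2 (- \<i> * t + 1)))))"
proof -
  obtain U1 p1 where U1: "unitary_mat n U1" "\<rho>1 = U1 * mat_diag n (\<lambda>i. complex_of_real (p1 i)) * mat_adjoint U1"
    and p1: "\<And>i. i < n \<Longrightarrow> 0 < p1 i" using pos_def_spectral[OF pos(1)] by blast
  obtain U2 p2 where U2: "unitary_mat n U2" "\<rho>2 = U2 * mat_diag n (\<lambda>i. complex_of_real (p2 i)) * mat_adjoint U2"
    and p2: "\<And>i. i < n \<Longrightarrow> 0 < p2 i" using pos_def_spectral[OF pos(2)] by blast
  obtain W1 q1 where W1: "unitary_mat n W1" "\<sigma>1 = W1 * mat_diag n (\<lambda>i. complex_of_real (q1 i)) * mat_adjoint W1"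
    and q1: "\<And>i. i < n \<Longrightarrow> 0 < q1 i" using pos_def_spectral[OF pos(3)] by blast
  obtain W2 q2 where W2: "unitary_mat n W2" "\<sigma>2 = W2 * mat_diag n (\<lambda>i. complex_of_real (q2 i)) * mat_adjoint W2"
    and q2: "\<And>i. i < n \<Longrightarrow> 0 < q2 i" using pos_def_spectral[OF pos(4)] by blast
  obtain U p where U: "unitary_mat n U" "\<rho>l = U * mat_diag n (\<lambda>i. complex_of_real (p i)) * mat_adjoint U"
    and p: "\<And>i. i < n \<Longrightarrow> 0 < p i"
    using pos_def_spectral[OF pos_def_combination[OF l pos(1,2)], folded \<rho>l] by blast
  obtain W q where W: "unitary_mat n W" "\<sigma>l = W * mat_diag n (\<lambda>i. complex_of_real (q i)) * mat_adjoint W"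
    and q: "\<And>i. i < n \<Longrightarrow> 0 < q i"
    using pos_def_spectral[OF pos_def_combination[OF l pos(3,4)], folded \<sigma>l] by blast
  \<comment> \<open>\<open>True\<close> labels the component with index 1.\<close>
  interpret mix: spectral_mixture n "\<lambda>b. if b then l else 1 - l" U W p q
    "\<lambda>b. if b then U1 else U2" "\<lambda>b. if b then W1 else W2" "\<lambda>b. if b then p1 else p2" "\<lambda>b. if b then q1 else q2"
  proof
    have \<rho>eq: "U * mat_diag n (\<lambda>i. complex_of_real (p i)) * mat_adjoint U = mat_combination l
      (U1 * mat_diag n (\<lambda>i. complex_of_real (p1 i)) * mat_adjoint U1)
      (U2 * mat_diag n (\<lambda>i. complex_of_real (p2 i)) * mat_adjoint U2)"
      using \<rho>l unfolding U(2) U1(2) U2(2) .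
    have \<sigma>eq: "W * mat_diag n (\<lambda>i. complex_of_real (q i)) * mat_adjoint W = mat_combination l
      (W1 * mat_diag n (\<lambda>i. complex_of_real (q1 i)) * mat_adjoint W1)
      (W2 * mat_diag n (\<lambda>i. complex_of_real (q2 i)) * mat_adjoint W2)"
      using \<sigma>l unfolding W(2) W1(2) W2(2) .
    fix i j assume ij: "i < n" "j < n"
    show "(\<Sum>b\<in>UNIV. complex_of_real (if b then l else 1 - l) * (\<Sum>k<n. overlap n U (if b then U1 else U2) i k *
        complex_of_real ((if b then p1 else p2) k) * overlap n (if b then U1 else U2) U k j))
      = (if i = j then complex_of_real (p i) else 0)"
      using combination_spectral_overlap[OF U(1) U1(1) U2(1) \<rho>eq ij] by (simp add: UNIV_bool add.commute)
    show "(\<Sum>b\<in>UNIV. complex_of_real (if b then l else 1 - l) * (\<Sum>k<n. overlap n W (if b then W1 else W2) i k *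
        complex_of_real ((if b then q1 else q2) k) * overlap n (if b then W1 else W2) W k j))
      = (if i = j then complex_of_real (q i) else 0)"
      using combination_spectral_overlap[OF W(1) W1(1) W2(1) \<sigma>eq ij] by (simp add: UNIV_bool add.commute)
  qed (use U W U1 U2 W1 W2 p p1 p2 l in auto)
  have e: "mix.e k \<in> I" if "k \<in> mix.L" for k
    using that spectrum_ratios[OF U(1) W(1) U(2) W(2) ratios(3)] by (auto simp: mix.e_def mix.L_def)
  have d: "mix.d k \<in> I" if "k \<in> mix.K" for k
    using that spectrum_ratios[OF U1(1) W1(1) U1(2) W1(2) ratios(1)] spectrum_ratios[OF U2(1) W2(1) U2(2) W2(2) ratios(2)]
    by (auto simp: mix.d_def mix.K_def)
  have Sl: "quantum_f_rel_entropy f \<rho>l \<sigma>l = (\<Sum>k\<in>mix.L. f (mix.e k) * (cmod (mix.x k))\<^sup>2)"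
    using mix.sum_x[of f] quantum_f_rel_entropy_spectral[OF U(1) W(1) p U(2) W(2), of f] by simp
  have S: "l * quantum_f_rel_entropy f \<rho>1 \<sigma>1 + (1 - l) * quantum_f_rel_entropy f \<rho>2 \<sigma>2
    = (\<Sum>k\<in>mix.K. f (mix.d k) * (cmod (\<Sum>m\<in>mix.L. mix.V k m * mix.x m))\<^sup>2)"
    using mix.sum_V_x[of f] quantum_f_rel_entropy_spectral[OF U1(1) W1(1) p1 U1(2) W1(2), of f]
      quantum_f_rel_entropy_spectral[OF U2(1) W2(1) p2 U2(2) W2(2), of f] by (simp add: UNIV_bool)
  have Tl: "mat_trace (mat_powc \<sigma>l z * mat_powc \<rho>l (- z + 1))
    = (\<Sum>k\<in>mix.L. exp (z * ln (mix.e k)) * complex_of_real ((cmod (mix.x k))\<^sup>2))" for z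
    unfolding mix.sum_x[of "\<lambda>t. exp (z * complex_of_real (ln t))"]
    by (rule trace_powc_spectral[OF U(1) W(1) p q U(2) W(2)])
  have T: "complex_of_real l * mat_trace (mat_powc \<sigma>1 z * mat_powc \<rho>1 (- z + 1))
      + complex_of_real (1 - l) * mat_trace (mat_powc \<sigma>2 z * mat_powc \<rho>2 (- z + 1))
    = (\<Sum>k\<in>mix.K. exp (z * ln (mix.d k)) * complex_of_real ((cmod (\<Sum>m\<in>mix.L. mix.V k m * mix.x m))\<^sup>2))" for z
    unfolding mix.sum_V_x[of "\<lambda>t. exp (z * complex_of_real (ln t))"]
    using trace_powc_spectral[OF U1(1) W1(1) p1 q1 U1(2) W1(2), of z]
      trace_powc_spectral[OF U2(1) W2(1) p2 q2 U2(2) W2(2), of z]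
    by (simp add: UNIV_bool)
  have "quantum_f_rel_entropy f \<rho>l \<sigma>l \<le> l * quantum_f_rel_entropy f \<rho>1 \<sigma>1 + (1 - l) * quantum_f_rel_entropy f \<rho>2 \<sigma>2"
    unfolding Sl S by (rule operator_jensen[OF mix.finite_K mix.finite_L convex d mix.V_isometry mix.V_compression])
  moreover have "quantum_f_rel_entropy f \<rho>l \<sigma>l = l * quantum_f_rel_entropy f \<rho>1 \<sigma>1 + (1 - l) * quantum_f_rel_entropy f \<rho>2 \<sigma>2
      \<longleftrightarrow> (\<forall>t::complex. mat_trace (mat_powc \<sigma>l (\<i> * t) * mat_powc \<rho>l (- \<i> * t + 1))
        = complex_of_real l * mat_trace (mat_powc \<sigma>1 (\<i> * t) * mat_powc \<rho>1 (- \<i> * t + 1))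
          + complex_of_real (1 - l) * mat_trace (mat_powc \<sigma>2 (\<i> * t) * mat_powc \<rho>2 (- \<i> * t + 1)))"
    if I: "I = {t\<^sub>0 - a<..<t\<^sub>0 + a}" and diff: "diffused t\<^sub>0 a f" for t\<^sub>0 a
  proof -
    have Ipos: "{t\<^sub>0 - a<..<t\<^sub>0 + a} \<subseteq> {0<..}" using dom(2) unfolding I by auto
    \<comment> \<open>Multiplication by the imaginary unit is a bijection of the complex plane, so
      the exponent z may range over all complex numbers.\<close>
    have surj: "(\<forall>z. P z) \<longleftrightarrow> (\<forall>t. P (\<i> * t))" for P :: "complex \<Rightarrow> bool"
    proof
      assume P: "\<forall>t. P (\<i> * t)"
      show "\<forall>z. P z"
      proof
        fix z show "P z" using P[rule_format, of "- \<i> * z"] by simp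
      qed
    qed blast
    have "quantum_f_rel_entropy f \<rho>l \<sigma>l = l * quantum_f_rel_entropy f \<rho>1 \<sigma>1 + (1 - l) * quantum_f_rel_entropy f \<rho>2 \<sigma>2
      \<longleftrightarrow> (\<forall>z. mat_trace (mat_powc \<sigma>l z * mat_powc \<rho>l (- z + 1))
        = complex_of_real l * mat_trace (mat_powc \<sigma>1 z * mat_powc \<rho>1 (- z + 1))
          + complex_of_real (1 - l) * mat_trace (mat_powc \<sigma>2 z * mat_powc \<rho>2 (- z + 1)))"
      unfolding Sl S Tl T
      using diffused_jensen_equality_iff[where K = mix.K and L = mix.L and V = mix.V and d = mix.d and e = mix.e and x = mix.x,
          OF mix.finite_K mix.finite_L diff Ipos d[unfolded I] e[unfolded I] mix.V_isometry mix.V_compression] .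
    also have "\<dots> \<longleftrightarrow> (\<forall>t. mat_trace (mat_powc \<sigma>l (\<i> * t) * mat_powc \<rho>l (- (\<i> * t) + 1))
        = complex_of_real l * mat_trace (mat_powc \<sigma>1 (\<i> * t) * mat_powc \<rho>1 (- (\<i> * t) + 1))
          + complex_of_real (1 - l) * mat_trace (mat_powc \<sigma>2 (\<i> * t) * mat_powc \<rho>2 (- (\<i> * t) + 1)))"
      by (rule surj)
    finally show ?thesis by (simp only: mult_minus_left)
  qed
  ultimately show ?thesis by blast
qed

end
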